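(* Let $d\ge 3$ and let $K\subset\mathbb{R}^d$ be a non-empty compact set. If \[ \lim_{s\downarrow 0}\int_{(s,\infty)} \big(P(\tilde{K}_t)\big)^{-1}\,dt=+\infty, \] then $\operatorname{cap}(K)=0$.
   Context: For a compact $K\subset\mathbb{R}^d$, $d\ge3$, the Newtonian capacity is $\operatorname{cap}(K)=\inf\{\int_{\mathbb{R}^d}|Du|^2:\ u\ge \mathbf 1_K,\ u\in D^1(\mathbb{R}^d)\cap C^0(\mathbb{R}^d)\}$, where $D^1(\mathbb{R}^d)$ is the set of $f\in L^1_{\rm loc}(\mathbb{R}^d)$ with $Df\in L^2(\mathbb{R}^d)$ that vanish at infinity, i.e. $|\{|f|>\varepsilon\}|<\infty$ for all $\varepsilon>0$. For a non-empty compact set $A$ and $r>0$, $A_r=\{x\in\mathbb{R}^d: \min_{y\in A}|x-y|\le r\}$. $U_K$ is the unbounded connected component of $\mathbb{R}^d\setminus K$ and $\tilde K=\mathbb{R}^d\setminus U_K$. $P(\cdot)$ denotes perimeter; for all but countably many $t>0$, $P(\tilde K_t)=\mathcal H^{d-1}(\partial \tilde K_t)$. *)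

theory Defs
  imports "HOL-Analysis.Analysis"
begin

definition C1c :: "('a::euclidean_space \<Rightarrow> 'b::real_normed_vector) \<Rightarrow> bool" where
  "C1c \<phi> \<longleftrightarrow> (\<forall>x. \<phi> differentiable (at x))
     \<and> (\<forall>i\<in>Basis. continuous_on UNIV (\<lambda>x. frechet_derivative \<phi> (at x) i))
     \<and> compact (closure {x. \<phi> x \<noteq> 0})"

definition weak_gradient :: "('a::euclidean_space \<Rightarrow> real) \<Rightarrow> ('a \<Rightarrow> 'a) \<Rightarrow> bool" where
  "weak_gradient u g \<longleftrightarrow> g \<in> borel_measurable lebesgue \<and>
     (\<forall>\<phi>::'a \<Rightarrow> real. C1c \<phi> \<longrightarrow> (\<forall>i\<in>Basis.
        (LINT x|lebesgue. u x * frechet_derivative \<phi> (at x) i)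
          = - (LINT x|lebesgue. (g x \<bullet> i) * \<phi> x)))"

definition D1_with_grad :: "('a::euclidean_space \<Rightarrow> real) \<Rightarrow> ('a \<Rightarrow> 'a) \<Rightarrow> bool" where
  "D1_with_grad f g \<longleftrightarrow> f \<in> borel_measurable lebesgue
     \<and> (\<forall>C. compact C \<longrightarrow> set_integrable lebesgue C f)
     \<and> weak_gradient f g
     \<and> integrable lebesgue (\<lambda>x. (norm (g x))\<^sup>2)
     \<and> (\<forall>\<epsilon>>0. emeasure lebesgue {x. \<bar>f x\<bar> > \<epsilon>} < \<infinity>)"

definition newton_cap :: "'a::euclidean_space set \<Rightarrow> ereal" where
  "newton_cap K = Inf (ereal ` {LINT x|lebesgue. (norm (g x))\<^sup>2 | u g.
      D1_with_grad u g \<and> continuous_on UNIV u \<and> (\<forall>x. indicator K x \<le> u x)})"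

definition nbhd :: "'a::euclidean_space set \<Rightarrow> real \<Rightarrow> 'a set" where
  "nbhd A r = {x. infdist x A \<le> r}"

definition filled :: "'a::euclidean_space set \<Rightarrow> 'a set" where
  "filled K = - \<Union>{C. C \<in> components (- K) \<and> \<not> bounded C}"

definition divergence :: "('a::euclidean_space \<Rightarrow> 'a) \<Rightarrow> 'a \<Rightarrow> real" where
  "divergence \<phi> x = (\<Sum>i\<in>Basis. frechet_derivative \<phi> (at x) i \<bullet> i)"

definition perimeter :: "'a::euclidean_space set \<Rightarrow> ennreal" where
  "perimeter E = (SUP \<phi>\<in>{\<phi>::'a \<Rightarrow> 'a. C1c \<phi> \<and> (\<forall>x. norm (\<phi> x) \<le> 1)}.
       ennreal (LINT x:E|lebesgue. divergence \<phi> x))"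

end

theory Submission
  imports Defs
begin

text \<open>
  Let \<open>F\<close> be the filled set, \<open>d = infdist _ F\<close> and \<open>P t\<close> the perimeter of \<open>nbhd F t\<close>.
  Testing the perimeter with fields \<open>\<psi> e\<close>, where \<open>e\<close> is a constant unit vector, shows that translating a
  compact set \<open>E\<close> by \<open>a\<close> sweeps out a volume of at most \<open>norm a\<close> times the perimeter of \<open>E\<close>. A point
  of the shell \<open>t < d \<le> t + r\<close> is moved into \<open>nbhd F t\<close> by a shift of length \<open>O(r)\<close> along one of the
  coordinate directions, so the shell has volume at most \<open>C r P t\<close>, for all \<open>r\<close> small relative to \<open>t\<close>.

  Choose a bounded \<open>h \<le> 1 / P\<close> supported in some \<open>{s<..R}\<close> with large integral \<open>c\<close>, and let
  \<open>u = H \<circ> d / c\<close> with \<open>H a = \<integral>\<^sub>a h\<close>. The shell bound and Tonelli's theorem show that the difference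
  quotients of \<open>u\<close> with a small step \<open>\<epsilon>\<close> have squared \<open>L\<^sup>2\<close> norm at most
  \<open>C / c\<^sup>2\<close> times the integral of \<open>h\<^sup>2 P \<le> h\<close>, that is, \<open>O(1 / c)\<close>.
  Averaging \<open>u\<close> over segments of length \<open>\<epsilon>\<close> in each coordinate direction turns the difference quotients
  into weak derivatives without increasing the \<open>L\<^sup>2\<close> norms, so the capacity is \<open>O(1 / c)\<close>.
\<close>

section \<open>Averages over segments and weak derivatives\<close>

text \<open>Bounded support is expressed by a radius instead of a closure, so products, differences
  and translates are controlled by the norm alone.\<close>

definition Cc :: "('a::euclidean_space \<Rightarrow> real) \<Rightarrow> bool" where
  "Cc f \<longleftrightarrow> continuous_on UNIV f \<and> (\<exists>R. \<forall>x. R < norm x \<longrightarrow> f x = 0)"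

text \<open>Convolution of \<open>w\<close> with the uniform probability measure on the segment from
  \<open>0\<close> to \<open>- a\<close>.\<close>

definition seg_avg :: "'a::euclidean_space \<Rightarrow> ('a \<Rightarrow> real) \<Rightarrow> 'a \<Rightarrow> real" where
  "seg_avg a w x = integral {0..1} (\<lambda>s. w (x + s *\<^sub>R a))"

definition weak_partial :: "'a::euclidean_space \<Rightarrow> ('a \<Rightarrow> real) \<Rightarrow> ('a \<Rightarrow> real) \<Rightarrow> bool" where
  "weak_partial i v g \<longleftrightarrow> (\<forall>\<phi>::'a \<Rightarrow> real. C1c \<phi> \<longrightarrow>
     (LINT x|lborel. v x * frechet_derivative \<phi> (at x) i) = - (LINT x|lborel. g x * \<phi> x))"

lemma Cc_continuous: "Cc f \<Longrightarrow> continuous_on UNIV f"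
  by (simp add: Cc_def)

lemma Cc_mult: "Cc f \<Longrightarrow> continuous_on UNIV g \<Longrightarrow> Cc (\<lambda>x. f x * g x)"
  unfolding Cc_def by (metis continuous_on_mult mult_zero_left)

lemma Cc_diff:
  assumes "Cc f" "Cc g"
  shows "Cc (\<lambda>x. f x - g x)"
proof -
  obtain R S where "\<forall>x. R < norm x \<longrightarrow> f x = 0" "\<forall>x. S < norm x \<longrightarrow> g x = 0"
    using assms unfolding Cc_def by blast
  then have "\<forall>x. max R S < norm x \<longrightarrow> f x - g x = 0"
    by simp
  then show ?thesis
    using assms unfolding Cc_def by (blast intro: continuous_on_diff)
qed

lemma Cc_divide: "Cc f \<Longrightarrow> Cc (\<lambda>x. f x / c)"
  using Cc_mult[of f "\<lambda>_. inverse c"] by (simp add: divide_inverse)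

lemma Cc_power2: "Cc f \<Longrightarrow> Cc (\<lambda>x. (f x)\<^sup>2)"
  using Cc_mult[of f f] by (simp add: Cc_continuous power2_eq_square)

lemma Cc_translate:
  assumes "Cc f"
  shows "Cc (\<lambda>x. f (x + a))"
proof -
  obtain R where R: "\<forall>x. R < norm x \<longrightarrow> f x = 0"
    using assms unfolding Cc_def by blast
  have "f (x + a) = 0" if "R + norm a < norm x" for x
    using R that norm_triangle_ineq4[of "x + a" a] by simp
  moreover have "continuous_on UNIV (\<lambda>x. f (x + a))"
    by (intro continuous_on_compose2[OF Cc_continuous[OF assms]] continuous_intros) auto
  ultimately show ?thesis
    unfolding Cc_def by blast
qed

lemma Cc_integrable:
  assumes "Cc f"
  shows "integrable lborel f"
proof -
  obtain R where R: "\<forall>x. R < norm x \<longrightarrow> f x = 0"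
    using assms unfolding Cc_def by blast
  have "integrable lborel (\<lambda>x. indicator (cball 0 R) x *\<^sub>R f x)"
    using assms by (intro borel_integrable_compact) (auto simp: Cc_def intro: continuous_on_subset)
  also have "(\<lambda>x. indicator (cball 0 R) x *\<^sub>R f x) = f"
    using R by (auto simp: indicator_def fun_eq_iff)
  finally show ?thesis .
qed

lemma integral_lborel_translate:
  fixes f :: "'a::euclidean_space \<Rightarrow> real"
  assumes [measurable]: "f \<in> borel_measurable borel"
  shows "(LINT x|lborel. f (x + a)) = (LINT x|lborel. f x)"
proof -
  have "(LINT x|lborel. f x) = (LINT x|distr lborel borel ((+) a). f x)"
    by (simp add: lborel_distr_plus)
  also have "\<dots> = (LINT x|lborel. f (a + x))"
    by (rule integral_distr) auto
  finally show ?thesis by (simp add: add.commute)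
qed

lemma nn_integral_lborel_translate:
  fixes f :: "'a::euclidean_space \<Rightarrow> ennreal"
  assumes [measurable]: "f \<in> borel_measurable borel"
  shows "(\<integral>\<^sup>+ x. f (x + a) \<partial>lborel) = (\<integral>\<^sup>+ x. f x \<partial>lborel)"
proof -
  have "(\<integral>\<^sup>+ x. f x \<partial>lborel) = (\<integral>\<^sup>+ x. f x \<partial>distr lborel borel ((+) a))"
    by (simp add: lborel_distr_plus)
  also have "\<dots> = (\<integral>\<^sup>+ x. f (a + x) \<partial>lborel)"
    by (rule nn_integral_distr) auto
  finally show ?thesis by (simp add: add.commute)
qed

section \<open>Fubini's theorem with a parameter in the unit interval\<close>

text \<open>On the compact set \<open>{0..1} \<times> closure E\<close> the continuous integrand is
  integrable, and cutting down to the Borel set \<open>{0..1} \<times> E\<close> preserves this, so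
  Fubini applies. \<open>E\<close> will be either the set of finite perimeter or a ball containing
  all supports.\<close>

lemma integral_swap_unit_interval:
  fixes f :: "real \<Rightarrow> 'a::euclidean_space \<Rightarrow> real"
  assumes cont: "continuous_on UNIV (\<lambda>(s, x). f s x)"
    and E: "E \<in> sets borel" "bounded E"
  shows "(\<lambda>s. LINT x|lborel. indicator E x * f s x) integrable_on {0..1}"
    and "integral {0..1} (\<lambda>s. LINT x|lborel. indicator E x * f s x)
       = (LINT x|lborel. indicator E x * integral {0..1} (\<lambda>s. f s x))"
proof -
  let ?S = "{0..1::real} \<times> closure E"
  let ?g = "\<lambda>(s, x). indicator {0..1} s * (indicator E x * f s x)"
  have "compact ?S"
    using E by (intro compact_Times) auto
  then have "integrable lborel (\<lambda>p. indicator ?S p *\<^sub>R (case p of (s, x) \<Rightarrow> f s x))"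
    by (intro borel_integrable_compact continuous_on_subset[OF cont]) auto
  then have "integrable lborel
      (\<lambda>p. indicator ({0..1} \<times> E) p *\<^sub>R (indicator ?S p *\<^sub>R (case p of (s, x) \<Rightarrow> f s x)))"
    by (rule integrable_mult_indicator[rotated]) (simp add: borel_Times E)
  also have "(\<lambda>p. indicator ({0..1} \<times> E) p *\<^sub>R (indicator ?S p *\<^sub>R (case p of (s, x) \<Rightarrow> f s x))) = ?g"
    using closure_subset[of E] by (auto simp: fun_eq_iff indicator_def)
  finally have int: "integrable (lborel \<Otimes>\<^sub>M lborel) ?g"
    by (simp add: lborel_prod)
  have sint: "set_integrable lborel {0..1} (\<lambda>s. LINT x|lborel. indicator E x * f s x)"
    using lborel_pair.integrable_fst'[OF int] by (simp add: set_integrable_def)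
  show "(\<lambda>s. LINT x|lborel. indicator E x * f s x) integrable_on {0..1}"
    using set_borel_integral_eq_integral(1)[OF sint] .
  have "integral {0..1} (\<lambda>s. LINT x|lborel. indicator E x * f s x)
      = (LINT s|lborel. (LINT x|lborel. ?g (s, x)))"
    using set_borel_integral_eq_integral(2)[OF sint] by (simp add: set_lebesgue_integral_def)
  also have "\<dots> = (LINT x|lborel. (LINT s|lborel. ?g (s, x)))"
    using lborel_pair.Fubini_integral[OF int] by simp
  also have "\<dots> = (LINT x|lborel. indicator E x * integral {0..1} (\<lambda>s. f s x))"
  proof (rule Bochner_Integration.integral_cong[OF refl])
    fix x
    have "continuous_on {0..1} (\<lambda>s. f s x)"
      using continuous_on_compose[of "{0..1}" "\<lambda>s. (s, x)", OF _ continuous_on_subset[OF cont]]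
      by (simp add: o_def continuous_on_Pair)
    then have "set_integrable lborel {0..1} (\<lambda>s. f s x)"
      unfolding set_integrable_def by (intro borel_integrable_compact) auto
    from set_borel_integral_eq_integral(2)[OF this]
    show "(LINT s|lborel. ?g (s, x)) = indicator E x * integral {0..1} (\<lambda>s. f s x)"
      by (simp add: set_lebesgue_integral_def mult.left_commute)
  qed
  finally show "integral {0..1} (\<lambda>s. LINT x|lborel. indicator E x * f s x)
       = (LINT x|lborel. indicator E x * integral {0..1} (\<lambda>s. f s x))" .
qed

lemma integral_swap_unit_interval_Cc:
  fixes f :: "real \<Rightarrow> 'a::euclidean_space \<Rightarrow> real"
  assumes cont: "continuous_on UNIV (\<lambda>(s, x). f s x)"
    and R: "\<And>s x. s \<in> {0..1} \<Longrightarrow> R < norm x \<Longrightarrow> f s x = 0"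
  shows "integral {0..1} (\<lambda>s. LINT x|lborel. f s x)
       = (LINT x|lborel. integral {0..1} (\<lambda>s. f s x))"
proof -
  have 1: "indicator (cball 0 R) x * f s x = f s x" if "s \<in> {0..1}" for s x
    using R[of s x] that by (auto simp: indicator_def)
  have 2: "indicator (cball 0 R) x * integral {0..1} (\<lambda>s. f s x) = integral {0..1} (\<lambda>s. f s x)" for x
    using R[of _ x] integral_cong[of "{0..1}" "\<lambda>s. f s x" "\<lambda>s. 0"]
    by (cases "R < norm x") (auto simp: indicator_def)
  have "integral {0..1} (\<lambda>s. LINT x|lborel. f s x)
      = integral {0..1} (\<lambda>s. LINT x|lborel. indicator (cball 0 R) x * f s x)"
    by (intro integral_cong Bochner_Integration.integral_cong) (auto simp: 1)
  then show ?thesis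
    using integral_swap_unit_interval(2)[OF cont, of "cball 0 R"] by (simp add: 2)
qed

lemma segment_vanishes:
  fixes w :: "'a::euclidean_space \<Rightarrow> real"
  assumes "\<forall>x. R < norm x \<longrightarrow> w x = 0" "s \<in> {0..1}" "R + norm a < norm x"
  shows "w (x + s *\<^sub>R a) = 0"
proof -
  have "norm (s *\<^sub>R a) \<le> norm a"
    using assms(2) by (auto intro: mult_left_le_one_le)
  then have "R < norm (x + s *\<^sub>R a)"
    using assms(3) norm_triangle_ineq4[of "x + s *\<^sub>R a" "s *\<^sub>R a"] by simp
  then show ?thesis using assms(1) by blast
qed

lemma segment_integrable:
  assumes "continuous_on UNIV (w :: 'a::euclidean_space \<Rightarrow> real)"
  shows "(\<lambda>s. w (x + s *\<^sub>R a)) integrable_on {0..1::real}"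
  by (intro integrable_continuous_real continuous_on_compose2[OF assms] continuous_intros) auto

lemma Cc_seg_avg:
  assumes "Cc w"
  shows "Cc (seg_avg a w)"
proof -
  obtain R where R: "\<forall>x. R < norm x \<longrightarrow> w x = 0"
    using assms unfolding Cc_def by blast
  have "continuous_on (UNIV \<times> cbox 0 1) (\<lambda>(x, s::real). w (x + s *\<^sub>R a))"
    unfolding case_prod_beta
    by (intro continuous_on_compose2[OF Cc_continuous[OF assms]] continuous_intros) auto
  from integral_continuous_on_param[OF this]
  have "continuous_on UNIV (seg_avg a w)"
    by (simp add: seg_avg_def[abs_def])
  moreover have "seg_avg a w x = 0" if "R + norm a < norm x" for x
  proof -
    have "seg_avg a w x = integral {0..1::real} (\<lambda>s. 0)"
      unfolding seg_avg_def by (intro integral_cong segment_vanishes[OF R _ that])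
    then show ?thesis by simp
  qed
  ultimately show ?thesis unfolding Cc_def by blast
qed

text \<open>Averaging is moved onto the test function with the direction reversed: swap the
  integrals, then translate by \<open>s *\<^sub>R a\<close> for each fixed \<open>s\<close>. Both
  weak derivative lemmas below rest on this adjointness.\<close>

lemma integral_seg_avg_mult:
  assumes "Cc w" "continuous_on UNIV \<psi>"
  shows "(LINT x|lborel. seg_avg a w x * \<psi> x)
       = integral {0..1} (\<lambda>s. LINT x|lborel. w x * \<psi> (x - s *\<^sub>R a))"
proof -
  obtain R where R: "\<forall>x. R < norm x \<longrightarrow> w x = 0"
    using assms unfolding Cc_def by blast
  have [measurable]: "\<psi> \<in> borel_measurable borel" "w \<in> borel_measurable borel"
    using assms by (auto intro: borel_measurable_continuous_onI Cc_continuous)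
  have "(LINT x|lborel. seg_avg a w x * \<psi> x)
      = (LINT x|lborel. integral {0..1} (\<lambda>s. w (x + s *\<^sub>R a) * \<psi> x))"
    by (simp add: seg_avg_def)
  also have "\<dots> = integral {0..1} (\<lambda>s. LINT x|lborel. w (x + s *\<^sub>R a) * \<psi> x)"
  proof (rule integral_swap_unit_interval_Cc[symmetric])
    show "continuous_on UNIV (\<lambda>(s, x). w (x + s *\<^sub>R a) * \<psi> x)"
      unfolding case_prod_beta
      by (intro continuous_on_compose2[OF Cc_continuous[OF assms(1)]]
          continuous_on_compose2[OF assms(2)] continuous_intros) auto
    show "w (x + s *\<^sub>R a) * \<psi> x = 0" if "s \<in> {0..1}" "R + norm a < norm x" for s x
      using segment_vanishes[OF R that] by simp
  qed
  also have "\<dots> = integral {0..1} (\<lambda>s. LINT x|lborel. w x * \<psi> (x - s *\<^sub>R a))"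
  proof (rule integral_cong)
    show "(LINT x|lborel. w (x + s *\<^sub>R a) * \<psi> x) = (LINT x|lborel. w x * \<psi> (x - s *\<^sub>R a))" for s
      using integral_lborel_translate[of "\<lambda>x. w x * \<psi> (x - s *\<^sub>R a)" "s *\<^sub>R a"] by simp
  qed
  finally show ?thesis .
qed

text \<open>Jensen's inequality on each segment.\<close>
lemma integral_seg_avg_power2_le:
  assumes "Cc w"
  shows "(LINT x|lborel. (seg_avg a w x)\<^sup>2) \<le> (LINT x|lborel. (w x)\<^sup>2)"
proof -
  have "(seg_avg a w x)\<^sup>2 \<le> seg_avg a (\<lambda>x. (w x)\<^sup>2) x" for x
  proof -
    let ?m = "seg_avg a w x"
    have cw: "continuous_on UNIV w" using assms by (rule Cc_continuous)
    have i1: "((\<lambda>s. w (x + s *\<^sub>R a)) has_integral ?m) {0..1}"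
      unfolding seg_avg_def by (intro integrable_integral segment_integrable cw)
    have i2: "((\<lambda>s. (w (x + s *\<^sub>R a))\<^sup>2) has_integral seg_avg a (\<lambda>x. (w x)\<^sup>2) x) {0..1}"
      unfolding seg_avg_def
      by (intro integrable_integral segment_integrable[where w="\<lambda>x. (w x)\<^sup>2"] continuous_intros cw)
    \<comment> \<open>Integrate \<open>(w - ?m)\<^sup>2 \<ge> 0\<close> over the segment. The
      parameter interval has length one, so the result is the mean of \<open>w\<^sup>2\<close> minus
      \<open>?m\<^sup>2\<close>.\<close>
    have "((\<lambda>s. (w (x + s *\<^sub>R a))\<^sup>2 - 2 * ?m * w (x + s *\<^sub>R a) + ?m\<^sup>2) has_integral
        (seg_avg a (\<lambda>x. (w x)\<^sup>2) x - 2 * ?m * ?m + ?m\<^sup>2)) {0..1}"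
      using has_integral_add[OF has_integral_diff[OF i2 has_integral_mult_right[OF i1]]
          has_integral_const_real[of "?m\<^sup>2" 0 1]] by simp
    then have "0 \<le> seg_avg a (\<lambda>x. (w x)\<^sup>2) x - 2 * ?m * ?m + ?m\<^sup>2"
    proof (rule has_integral_nonneg)
      fix s
      have "0 \<le> (w (x + s *\<^sub>R a) - ?m)\<^sup>2" by simp
      then show "0 \<le> (w (x + s *\<^sub>R a))\<^sup>2 - 2 * ?m * w (x + s *\<^sub>R a) + ?m\<^sup>2"
        by (simp add: power2_eq_square algebra_simps)
    qed
    then show ?thesis by (simp add: power2_eq_square)
  qed
  then have "(LINT x|lborel. (seg_avg a w x)\<^sup>2) \<le> (LINT x|lborel. seg_avg a (\<lambda>x. (w x)\<^sup>2) x)"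
    by (intro integral_mono Cc_integrable Cc_power2 Cc_seg_avg assms)
  \<comment> \<open>Pairing with the constant \<open>1\<close> shows that averaging preserves the
    integral.\<close>
  also have "\<dots> = (LINT x|lborel. (w x)\<^sup>2)"
    using integral_seg_avg_mult[OF Cc_power2[OF assms], of "\<lambda>_. 1" a] by simp
  finally show ?thesis .
qed

section \<open>Test functions and weak derivatives of averages\<close>

lemma C1c_has_derivative:
  "C1c \<phi> \<Longrightarrow> (\<phi> has_derivative frechet_derivative \<phi> (at x)) (at x)"
  by (simp add: C1c_def frechet_derivative_works)

lemma frechet_derivative_translate:
  assumes "C1c \<phi>"
  shows "frechet_derivative (\<lambda>x. \<phi> (x + a)) (at x) = frechet_derivative \<phi> (at (x + a))"
proof -
  have "((\<lambda>x. x + a) has_derivative (\<lambda>h. h)) (at x)"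
    by (auto intro!: derivative_eq_intros)
  from has_derivative_compose[OF this C1c_has_derivative[OF assms]]
  show ?thesis
    by (intro frechet_derivative_at[symmetric])
qed

lemma C1cI:
  assumes "\<And>x. (\<phi> has_derivative D x) (at x)" "\<And>i. i \<in> Basis \<Longrightarrow> continuous_on UNIV (\<lambda>x. D x i)"
    and "\<And>x. R < norm x \<Longrightarrow> \<phi> x = 0"
  shows "C1c \<phi>"
proof -
  have D: "frechet_derivative \<phi> (at x) = D x" for x
    using assms(1) frechet_derivative_at by metis
  have "{x. \<phi> x \<noteq> 0} \<subseteq> cball 0 R"
    using assms(3) by (force simp: not_less)
  then have "compact (closure {x. \<phi> x \<noteq> 0})"
    using bounded_cball bounded_subset compact_closure by blast
  then show ?thesis
    using assms(1,2) by (auto simp: C1c_def D differentiable_def)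
qed

lemma C1c_Cc:
  fixes \<phi> :: "'a::euclidean_space \<Rightarrow> real"
  assumes "C1c \<phi>"
  shows "Cc \<phi>" "Cc (\<lambda>x. frechet_derivative \<phi> (at x) e)"
proof -
  let ?S = "closure {x. \<phi> x \<noteq> 0}"
  have "bounded ?S"
    using assms by (simp add: C1c_def compact_imp_bounded)
  then obtain R where R: "\<And>x. x \<in> ?S \<Longrightarrow> norm x \<le> R"
    using bounded_iff by metis
  have z: "\<phi> x = 0" if "R < norm x" for x
    using R[of x] that closure_subset[of "{x. \<phi> x \<noteq> 0}"] by fastforce
  have "continuous_on UNIV \<phi>"
    using assms by (auto simp: C1c_def intro!: differentiable_imp_continuous_on simp: differentiable_on_def)
  then show "Cc \<phi>" using z unfolding Cc_def by blast
  have dz: "frechet_derivative \<phi> (at x) e = 0" if "R < norm x" for x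
  proof -
    have "open {x::'a. R < norm x}"
      by (intro open_Collect_less continuous_intros)
    then have "(\<phi> has_derivative (\<lambda>h. 0)) (at x)"
      using that z
      by (intro has_derivative_transform_within_open[OF has_derivative_const, where s="{x. R < norm x}"]) auto
    then show ?thesis
      using frechet_derivative_at by metis
  qed
  \<comment> \<open>\<open>C1c\<close> gives continuity of the derivative in basis directions only;
    linearity extends it to every direction \<open>e\<close>.\<close>
  have "frechet_derivative \<phi> (at x) e = (\<Sum>i\<in>Basis. (e \<bullet> i) * frechet_derivative \<phi> (at x) i)" for x
  proof -
    interpret linear "frechet_derivative \<phi> (at x)"
      using C1c_has_derivative[OF assms] has_derivative_linear by blast
    have "frechet_derivative \<phi> (at x) (\<Sum>i\<in>Basis. (e \<bullet> i) *\<^sub>R i) = (\<Sum>i\<in>Basis. (e \<bullet> i) * frechet_derivative \<phi> (at x) i)"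
      by (simp add: sum scaleR)
    then show ?thesis by (simp add: euclidean_representation)
  qed
  then have "continuous_on UNIV (\<lambda>x. frechet_derivative \<phi> (at x) e)"
    using assms by (auto simp: C1c_def intro!: continuous_intros)
  then show "Cc (\<lambda>x. frechet_derivative \<phi> (at x) e)"
    using dz unfolding Cc_def by blast
qed

lemma C1c_translate:
  fixes \<phi> :: "'a::euclidean_space \<Rightarrow> real"
  assumes "C1c \<phi>"
  shows "C1c (\<lambda>x. \<phi> (x + a))"
proof -
  obtain R where "\<forall>x. R < norm x \<longrightarrow> \<phi> (x + a) = 0"
    using Cc_translate[OF C1c_Cc(1)[OF assms], of a] unfolding Cc_def by blast
  moreover have "((\<lambda>x. \<phi> (x + a)) has_derivative frechet_derivative \<phi> (at (x + a))) (at x)" for x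
    by (rule has_derivative_compose[OF _ C1c_has_derivative[OF assms], of "\<lambda>x. x + a" "\<lambda>h. h"])
       (auto intro!: derivative_eq_intros)
  ultimately show ?thesis
    using Cc_translate[OF C1c_Cc(2)[OF assms], of a]
    by (intro C1cI[where D="\<lambda>x. frechet_derivative \<phi> (at (x + a))"]) (auto simp: Cc_def)
qed

lemma integral_derivative_segment:
  fixes \<phi> :: "'a::euclidean_space \<Rightarrow> real"
  assumes "C1c \<phi>"
  shows "integral {0..1} (\<lambda>s. frechet_derivative \<phi> (at (x + s *\<^sub>R a)) a) = \<phi> (x + a) - \<phi> x"
proof -
  have "((\<lambda>s. \<phi> (x + s *\<^sub>R a)) has_vector_derivative frechet_derivative \<phi> (at (x + s *\<^sub>R a)) a)
      (at s within {0..1})" for s :: real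
  proof -
    have "((\<lambda>s. x + s *\<^sub>R a) has_derivative (\<lambda>h. h *\<^sub>R a)) (at s within {0..1})"
      by (auto intro!: derivative_eq_intros)
    from has_derivative_compose[OF this C1c_has_derivative[OF assms]]
    show ?thesis
      using linear_cmul[OF has_derivative_linear[OF C1c_has_derivative[OF assms]]]
      unfolding has_vector_derivative_def by simp
  qed
  from fundamental_theorem_of_calculus[OF _ this] show ?thesis
    by (simp add: integral_unique)
qed

text \<open>Averaging in direction \<open>i\<close> turns a merely continuous function into one with
  a weak \<open>i\<close>-th derivative. On the test function side the average of its derivative
  along the reversed segment is a difference quotient, by the fundamental theorem of calculus; a
  translation moves that quotient onto \<open>v\<close>.\<close>

lemma weak_partial_seg_avg_self:
  fixes v :: "'a::euclidean_space \<Rightarrow> real"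
  assumes v: "Cc v" and "\<epsilon> \<noteq> 0"
  shows "weak_partial i (seg_avg (\<epsilon> *\<^sub>R i) v) (\<lambda>x. (v (x + \<epsilon> *\<^sub>R i) - v x) / \<epsilon>)"
  unfolding weak_partial_def
proof (intro allI impI)
  fix \<phi> :: "'a \<Rightarrow> real" assume \<phi>: "C1c \<phi>"
  let ?a = "\<epsilon> *\<^sub>R i" and ?D = "\<lambda>x. frechet_derivative \<phi> (at x) i"
  obtain R where R: "\<forall>x. R < norm x \<longrightarrow> v x = 0"
    using v unfolding Cc_def by blast
  have cv: "continuous_on UNIV v" and cD: "continuous_on UNIV ?D" and c\<phi>: "continuous_on UNIV \<phi>"
    using v C1c_Cc[OF \<phi>] by (auto intro: Cc_continuous)
  have [measurable]: "v \<in> borel_measurable borel" "\<phi> \<in> borel_measurable borel"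
    using cv c\<phi> by (auto intro: borel_measurable_continuous_onI)
  have "(LINT x|lborel. seg_avg ?a v x * ?D x)
      = integral {0..1} (\<lambda>s. LINT x|lborel. v x * ?D (x - s *\<^sub>R ?a))"
    by (rule integral_seg_avg_mult[OF v cD])
  also have "\<dots> = (LINT x|lborel. integral {0..1} (\<lambda>s. v x * ?D (x - s *\<^sub>R ?a)))"
  proof (rule integral_swap_unit_interval_Cc)
    show "continuous_on UNIV (\<lambda>(s, x). v x * ?D (x - s *\<^sub>R ?a))"
      unfolding case_prod_beta
      by (intro continuous_on_compose2[OF cv] continuous_on_compose2[OF cD] continuous_intros) auto
  qed (use R in auto)
  also have "\<dots> = (LINT x|lborel. v x * ((\<phi> x - \<phi> (x - ?a)) / \<epsilon>))"
  proof (rule Bochner_Integration.integral_cong[OF refl])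
    fix x
    have "frechet_derivative \<phi> (at y) (- ?a) = - \<epsilon> * ?D y" for y
      using linear_cmul[OF has_derivative_linear[OF C1c_has_derivative[OF \<phi>]], of y "- \<epsilon>" i]
      by simp
    then have "- \<epsilon> * integral {0..1} (\<lambda>s. ?D (x - s *\<^sub>R ?a)) = \<phi> (x - ?a) - \<phi> x"
      using integral_derivative_segment[OF \<phi>, of x "- ?a"] by simp
    then have "integral {0..1} (\<lambda>s. ?D (x - s *\<^sub>R ?a)) = (\<phi> x - \<phi> (x - ?a)) / \<epsilon>"
      using \<open>\<epsilon> \<noteq> 0\<close> by (simp add: field_simps)
    then show "integral {0..1} (\<lambda>s. v x * ?D (x - s *\<^sub>R ?a)) = v x * ((\<phi> x - \<phi> (x - ?a)) / \<epsilon>)"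
      by simp
  qed
  also have "\<dots> = (LINT x|lborel. v x * \<phi> x / \<epsilon>) - (LINT x|lborel. v x * \<phi> (x - ?a) / \<epsilon>)"
  proof (subst Bochner_Integration.integral_diff[symmetric])
    show "integrable lborel (\<lambda>x. v x * \<phi> x / \<epsilon>)" "integrable lborel (\<lambda>x. v x * \<phi> (x - ?a) / \<epsilon>)"
      using Cc_translate[OF C1c_Cc(1)[OF \<phi>], of "- ?a"]
      by (auto intro!: Cc_integrable Cc_divide Cc_mult v c\<phi> intro: Cc_continuous)
  qed (simp add: algebra_simps diff_divide_distrib)
  \<comment> \<open>Substitute \<open>x + ?a\<close> for \<open>x\<close>, so that the shift falls
    on \<open>v\<close> instead of the test function.\<close>
  also have "(LINT x|lborel. v x * \<phi> (x - ?a) / \<epsilon>) = (LINT x|lborel. v (x + ?a) * \<phi> x / \<epsilon>)"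
    using integral_lborel_translate[of "\<lambda>x. v x * \<phi> (x - ?a) / \<epsilon>" ?a, symmetric]
    by (simp only: add_diff_cancel) simp
  also have "(LINT x|lborel. v x * \<phi> x / \<epsilon>) - (LINT x|lborel. v (x + ?a) * \<phi> x / \<epsilon>)
      = - (LINT x|lborel. (v (x + ?a) - v x) / \<epsilon> * \<phi> x)"
  proof -
    have "integrable lborel (\<lambda>x. v x * \<phi> x / \<epsilon>)" "integrable lborel (\<lambda>x. v (x + ?a) * \<phi> x / \<epsilon>)"
      by (auto intro!: Cc_integrable Cc_divide Cc_mult v c\<phi> Cc_translate)
    from Bochner_Integration.integral_diff[OF this(2,1)]
    show ?thesis by (simp add: left_diff_distrib diff_divide_distrib)
  qed
  finally show "(LINT x|lborel. seg_avg ?a v x * ?D x)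
      = - (LINT x|lborel. (v (x + ?a) - v x) / \<epsilon> * \<phi> x)" .
qed

text \<open>Averaging commutes with weak differentiation: translates of a test function are again
  test functions, so the weak identity for \<open>v\<close> can be integrated over the
  shifts.\<close>

lemma weak_partial_seg_avg:
  fixes v :: "'a::euclidean_space \<Rightarrow> real"
  assumes v: "Cc v" and g: "Cc g" and w: "weak_partial j v g"
  shows "weak_partial j (seg_avg a v) (seg_avg a g)"
  unfolding weak_partial_def
proof (intro allI impI)
  fix \<phi> :: "'a \<Rightarrow> real" assume \<phi>: "C1c \<phi>"
  have eq: "(LINT x|lborel. v x * frechet_derivative \<phi> (at (x - s *\<^sub>R a)) j)
      = - (LINT x|lborel. g x * \<phi> (x - s *\<^sub>R a))" for s
    using w C1c_translate[OF \<phi>, of "- (s *\<^sub>R a)"] frechet_derivative_translate[OF \<phi>, of "- (s *\<^sub>R a)"]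
    unfolding weak_partial_def by force
  have "(LINT x|lborel. seg_avg a v x * frechet_derivative \<phi> (at x) j)
      = integral {0..1} (\<lambda>s. LINT x|lborel. v x * frechet_derivative \<phi> (at (x - s *\<^sub>R a)) j)"
    by (intro integral_seg_avg_mult v Cc_continuous C1c_Cc \<phi>)
  also have "\<dots> = integral {0..1} (\<lambda>s. - (LINT x|lborel. g x * \<phi> (x - s *\<^sub>R a)))"
    by (simp only: eq)
  also have "integral {0..1} (\<lambda>s. - (LINT x|lborel. g x * \<phi> (x - s *\<^sub>R a)))
      = - (LINT x|lborel. seg_avg a g x * \<phi> x)"
    using integral_seg_avg_mult[OF g Cc_continuous[OF C1c_Cc(1)[OF \<phi>]], of a] by simp
  finally show "(LINT x|lborel. seg_avg a v x * frechet_derivative \<phi> (at x) j)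
      = - (LINT x|lborel. seg_avg a g x * \<phi> x)" .
qed

section \<open>Perimeter and translations\<close>

lemma real_polynomial_function_C1:
  fixes p :: "'a::real_normed_vector \<Rightarrow> real"
  assumes "real_polynomial_function p"
  shows "\<exists>D. (\<forall>x. (p has_derivative D x) (at x)) \<and> (\<forall>e. continuous_on UNIV (\<lambda>x. D x e))"
  using assms
proof induction
  case (linear f)
  then show ?case
    by (intro exI[of _ "\<lambda>_. f"]) (auto intro: bounded_linear_imp_has_derivative)
next
  case (const c)
  then show ?case by (intro exI[of _ "\<lambda>_ _. 0"]) auto
next
  case (add f g)
  then obtain F G where FG: "\<forall>x. (f has_derivative F x) (at x)" "\<forall>x. (g has_derivative G x) (at x)"
    "\<forall>e. continuous_on UNIV (\<lambda>x. F x e)" "\<forall>e. continuous_on UNIV (\<lambda>x. G x e)"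
    by blast
  then show ?case
    by (intro exI[of _ "\<lambda>x h. F x h + G x h"]) (auto intro!: has_derivative_add continuous_intros)
next
  case (mult f g)
  then obtain F G where FG: "\<forall>x. (f has_derivative F x) (at x)" "\<forall>x. (g has_derivative G x) (at x)"
    "\<forall>e. continuous_on UNIV (\<lambda>x. F x e)" "\<forall>e. continuous_on UNIV (\<lambda>x. G x e)"
    by blast
  have "continuous_on UNIV f" "continuous_on UNIV g"
    using mult.hyps by (auto intro!: continuous_at_imp_continuous_on continuous_real_polymonial_function)
  with FG show ?case
    by (intro exI[of _ "\<lambda>x h. f x * G x h + F x h * g x"]) (auto intro!: has_derivative_mult continuous_intros)
qed

text \<open>Squaring the positive part removes the kink at \<open>0\<close>. This is the profile of
  the bump used in the next lemma.\<close>

lemma has_real_derivative_max_0_power2: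
  "((\<lambda>s::real. (max 0 s)\<^sup>2) has_real_derivative 2 * max 0 s) (at s)"
proof -
  consider "s < 0" | "s = 0" | "s > 0" by linarith
  then show ?thesis
  proof cases
    case 1
    have "((\<lambda>s::real. 0) has_real_derivative 0) (at s)" by simp
    then have "((\<lambda>s::real. (max 0 s)\<^sup>2) has_real_derivative 0) (at s)"
      by (rule has_field_derivative_transform_within_open[where S="{..<0}"]) (use 1 in auto)
    then show ?thesis using 1 by simp
  next
    case 2
    have "((\<lambda>h::real. (max 0 h)\<^sup>2 / h) \<longlongrightarrow> 0) (at 0)"
    proof (rule tendsto_rabs_zero_cancel, rule tendsto_sandwich)
      show "\<forall>\<^sub>F h::real in at 0. 0 \<le> \<bar>(max 0 h)\<^sup>2 / h\<bar>" by simp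
      show "\<forall>\<^sub>F h::real in at 0. \<bar>(max 0 h)\<^sup>2 / h\<bar> \<le> \<bar>h\<bar>"
        by (simp add: power2_eq_square max_def)
      show "((\<lambda>h::real. \<bar>h\<bar>) \<longlongrightarrow> 0) (at 0)"
        by (intro tendsto_rabs_zero tendsto_ident_at)
    qed simp
    then show ?thesis using 2 by (simp add: DERIV_def)
  next
    case 3
    have "((\<lambda>s::real. s\<^sup>2) has_real_derivative 2 * s) (at s)"
      by (auto intro!: derivative_eq_intros)
    then have "((\<lambda>s::real. (max 0 s)\<^sup>2) has_real_derivative 2 * s) (at s)"
      by (rule has_field_derivative_transform_within_open[where S="{0<..}"]) (use 3 in auto)
    then show ?thesis using 3 by simp
  qed
qed

text \<open>Dividing \<open>g\<close> by a \<open>C\<^sup>1\<close> bump \<open>\<eta>\<close> before applying Stone--Weierstrass makes the product of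
  the polynomial with \<open>\<eta>\<close> automatically compactly supported and uniformly close to \<open>g\<close>.\<close>
lemma C1c_uniformly_dense:
  fixes g :: "'a::euclidean_space \<Rightarrow> real"
  assumes g: "Cc g" and e: "0 < e"
  obtains \<psi> where "C1c \<psi>" "\<And>x. \<bar>\<psi> x - g x\<bar> \<le> e"
proof -
  obtain R0 where R0: "\<forall>x. R0 < norm x \<longrightarrow> g x = 0"
    using g unfolding Cc_def by blast
  \<comment> \<open>\<open>R0\<close> may be negative, hence the maximum. The bump
    \<open>\<eta>\<close> lives on the ball of radius \<open>R\<close> and is at least
    \<open>m > 0\<close> on the smaller ball of radius \<open>r\<close>, outside which
    \<open>g\<close> vanishes.\<close>
  define r where "r = max 0 R0"
  define R where "R = r + 1"
  define \<eta> where "\<eta> = (\<lambda>x::'a. (max 0 (R\<^sup>2 - x \<bullet> x))\<^sup>2)"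
  define m where "m = (R\<^sup>2 - r\<^sup>2)\<^sup>2"
  have r: "0 \<le> r" "r < R" "0 < R" by (auto simp: r_def R_def)
  have gz: "g x = 0" if "r < norm x" for x
    using that R0 by (simp add: r_def)
  have m: "0 < m"
    using r by (auto simp: m_def power2_eq_iff_nonneg)
  have \<eta>m: "m \<le> \<eta> x" if "norm x \<le> r" for x
  proof -
    have "(norm x)\<^sup>2 \<le> r\<^sup>2" "r\<^sup>2 \<le> R\<^sup>2"
      using that r by (auto intro: power_mono)
    then show ?thesis
      by (auto simp: m_def \<eta>_def dot_square_norm intro!: power_mono)
  qed
  have \<eta>z: "\<eta> x = 0" if "R < norm x" for x
  proof -
    have "R\<^sup>2 \<le> (norm x)\<^sup>2" using that r by (intro power_mono) auto
    then show ?thesis by (simp add: \<eta>_def dot_square_norm)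
  qed
  have \<eta>le: "0 \<le> \<eta> x" "\<eta> x \<le> R^4" for x
  proof -
    have "(max 0 (R\<^sup>2 - x \<bullet> x))\<^sup>2 \<le> (R\<^sup>2)\<^sup>2"
      by (intro power_mono) auto
    then show "\<eta> x \<le> R^4" by (simp add: \<eta>_def)
  qed (simp add: \<eta>_def)
  have \<eta>': "(\<eta> has_derivative (\<lambda>h. 2 * max 0 (R\<^sup>2 - x \<bullet> x) * (- 2 * (x \<bullet> h)))) (at x)" for x
  proof -
    have "((\<lambda>x::'a. R\<^sup>2 - x \<bullet> x) has_derivative (\<lambda>h. - 2 * (x \<bullet> h))) (at x)"
      by (auto intro!: derivative_eq_intros simp: inner_commute)
    from has_derivative_compose[OF this has_real_derivative_max_0_power2[unfolded has_field_derivative_def]]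
    show ?thesis by (simp add: \<eta>_def)
  qed
  have c\<eta>: "continuous_on UNIV \<eta>"
    unfolding \<eta>_def by (intro continuous_intros)
  \<comment> \<open>The lower cutoff \<open>m\<close> avoids division by zero near the sphere of
    radius \<open>R\<close>. Where it is active, \<open>\<eta> x < m\<close> forces
    \<open>r < norm x\<close>, so \<open>g x = 0\<close> and the quotient times
    \<open>\<eta>\<close> is still \<open>g\<close>.\<close>
  have "continuous_on (cball 0 R) (\<lambda>x. g x / max (\<eta> x) m)"
    using m by (intro continuous_intros continuous_on_subset[OF c\<eta>] continuous_on_subset[OF Cc_continuous[OF g]])
      (auto simp: max_def)
  \<comment> \<open>The tolerance is \<open>e / R^4\<close> because multiplication by
    \<open>\<eta> \<le> R^4\<close> brings the error back to \<open>e\<close>.\<close>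
  then obtain p where p: "real_polynomial_function p"
      "\<And>x. x \<in> cball 0 R \<Longrightarrow> \<bar>g x / max (\<eta> x) m - p x\<bar> < e / R^4"
    using Stone_Weierstrass_real_polynomial_function[of "cball 0 R" _ "e / R^4"] e r by auto
  obtain D where D: "\<forall>x. (p has_derivative D x) (at x)" "\<forall>e. continuous_on UNIV (\<lambda>x. D x e)"
    using real_polynomial_function_C1[OF p(1)] by blast
  have cp: "continuous_on UNIV p"
    using p(1) by (auto intro!: continuous_at_imp_continuous_on continuous_real_polymonial_function)
  show ?thesis
  proof
    show "C1c (\<lambda>x. p x * \<eta> x)"
    proof (rule C1cI)
      show "((\<lambda>x. p x * \<eta> x) has_derivative
          (\<lambda>h. p x * (2 * max 0 (R\<^sup>2 - x \<bullet> x) * (- 2 * (x \<bullet> h))) + D x h * \<eta> x)) (at x)" for x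
        using D(1) \<eta>' by (intro has_derivative_mult) auto
      show "continuous_on UNIV (\<lambda>x. p x * (2 * max 0 (R\<^sup>2 - x \<bullet> x) * (- 2 * (x \<bullet> i))) + D x i * \<eta> x)" for i
        using D(2) by (intro continuous_intros cp c\<eta>) auto
      show "p x * \<eta> x = 0" if "R < norm x" for x
        using \<eta>z[OF that] by simp
    qed
    show "\<bar>p x * \<eta> x - g x\<bar> \<le> e" for x
    proof (cases "R < norm x")
      case True
      then show ?thesis using \<eta>z gz r e by simp
    next
      case False
      define q where "q = g x / max (\<eta> x) m"
      have eq: "g x = q * \<eta> x" unfolding q_def
        using gz[of x] \<eta>m[of x] m by (cases "r < norm x") (auto simp: max_def)
      have "\<bar>p x * \<eta> x - g x\<bar> = \<bar>q - p x\<bar> * \<eta> x"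
        using \<eta>le(1)[of x] by (simp add: eq abs_mult abs_minus_commute flip: left_diff_distrib)
      also have "\<dots> \<le> e / R^4 * R^4"
        using p(2)[of x] False \<eta>le[of x] by (intro mult_mono) (auto simp: q_def)
      finally show ?thesis using r by simp
    qed
  qed
qed

section \<open>Perimeter bounds for directional derivatives and increments\<close>

lemma divergence_scaleR_const:
  assumes "C1c \<psi>"
  shows "divergence (\<lambda>x. \<psi> x *\<^sub>R e) x = frechet_derivative \<psi> (at x) e"
proof -
  have "((\<lambda>x. \<psi> x *\<^sub>R e) has_derivative (\<lambda>h. frechet_derivative \<psi> (at x) h *\<^sub>R e)) (at x)"
    using C1c_has_derivative[OF assms] by (intro has_derivative_scaleR_left)
  then have "frechet_derivative (\<lambda>x. \<psi> x *\<^sub>R e) (at x) = (\<lambda>h. frechet_derivative \<psi> (at x) h *\<^sub>R e)"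
    by (rule frechet_derivative_at[symmetric])
  then have "divergence (\<lambda>x. \<psi> x *\<^sub>R e) x = (\<Sum>i\<in>Basis. (e \<bullet> i) * frechet_derivative \<psi> (at x) i)"
    by (simp add: divergence_def mult.commute)
  also have "\<dots> = frechet_derivative \<psi> (at x) (\<Sum>i\<in>Basis. (e \<bullet> i) *\<^sub>R i)"
    using has_derivative_linear[OF C1c_has_derivative[OF assms]]
    by (simp add: linear_sum linear_cmul)
  finally show ?thesis by (simp add: euclidean_representation)
qed

lemma C1c_scaleR_const:
  fixes \<psi> :: "'a::euclidean_space \<Rightarrow> real"
  assumes "C1c \<psi>"
  shows "C1c (\<lambda>x. \<psi> x *\<^sub>R e)"
proof -
  obtain R where "\<forall>x. R < norm x \<longrightarrow> \<psi> x = 0"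
    using C1c_Cc(1)[OF assms] unfolding Cc_def by blast
  then show ?thesis
    using C1c_has_derivative[OF assms] Cc_continuous[OF C1c_Cc(2)[OF assms]]
    by (intro C1cI[where D="\<lambda>x h. frechet_derivative \<psi> (at x) h *\<^sub>R e"])
       (auto intro!: has_derivative_scaleR_left continuous_intros)
qed

text \<open>The field \<open>\<psi> x *\<^sub>R e\<close> with \<open>e = a /\<^sub>R norm a\<close>
  competes in the supremum defining the perimeter, and its divergence is the derivative of
  \<open>\<psi>\<close> along \<open>e\<close>. Linearity restores the factor
  \<open>norm a\<close>.\<close>

lemma integral_derivative_le_perimeter:
  fixes E :: "'a::euclidean_space set"
  assumes E: "E \<in> sets borel" and fin: "perimeter E < \<infinity>"
    and \<psi>: "C1c \<psi>" "\<And>x. \<bar>\<psi> x\<bar> \<le> 1"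
  shows "(LINT x|lborel. indicator E x * frechet_derivative \<psi> (at x) a) \<le> norm a * enn2real (perimeter E)"
proof (cases "a = 0")
  case True
  then show ?thesis
    using linear_0[OF has_derivative_linear[OF C1c_has_derivative[OF \<psi>(1)]]] by simp
next
  case False
  define e where "e = a /\<^sub>R norm a"
  have a: "a = norm a *\<^sub>R e" and ne: "norm e = 1" using False by (auto simp: e_def)
  have [measurable]: "E \<in> sets borel" "(\<lambda>x. frechet_derivative \<psi> (at x) e) \<in> borel_measurable borel"
    using E C1c_Cc(2)[OF \<psi>(1)] by (auto intro: borel_measurable_continuous_onI Cc_continuous)
  let ?I = "LINT x|lborel. indicator E x * frechet_derivative \<psi> (at x) e"
  have "(LINT x:E|lebesgue. divergence (\<lambda>x. \<psi> x *\<^sub>R e) x)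
      = (LINT x|lebesgue. indicator E x * frechet_derivative \<psi> (at x) e)"
    by (simp add: set_lebesgue_integral_def divergence_scaleR_const[OF \<psi>(1)])
  also have "\<dots> = ?I"
    by (rule integral_completion) simp
  finally have "ennreal ?I = ennreal (LINT x:E|lebesgue. divergence (\<lambda>x. \<psi> x *\<^sub>R e) x)" by simp
  also have "\<dots> \<le> perimeter E"
    unfolding perimeter_def using C1c_scaleR_const[OF \<psi>(1)] \<psi>(2) ne by (intro SUP_upper) auto
  also have "perimeter E = ennreal (enn2real (perimeter E))"
    using fin by simp
  \<comment> \<open>\<open>ennreal\<close> truncates a negative \<open>?I\<close> to zero, which is
    harmless because the bound is nonnegative.\<close>
  finally have "?I \<le> enn2real (perimeter E)"
    by (simp add: ennreal_le_iff)
  moreover have "frechet_derivative \<psi> (at x) a = norm a * frechet_derivative \<psi> (at x) e" for x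
    using linear_cmul[OF has_derivative_linear[OF C1c_has_derivative[OF \<psi>(1)]], of x "norm a" e] a by simp
  ultimately show ?thesis
    by (simp add: mult.left_commute mult_left_mono)
qed

text \<open>The increment is the integral of the derivative along the segment from \<open>x\<close>
  to \<open>x + a\<close>. After exchanging integrals, each \<open>s\<close> contributes a translate
  of \<open>\<psi>\<close>, to which the preceding bound applies.\<close>

lemma integral_increment_le_perimeter_C1c:
  fixes E :: "'a::euclidean_space set"
  assumes E: "E \<in> sets borel" "bounded E" and fin: "perimeter E < \<infinity>"
    and \<psi>: "C1c \<psi>" "\<And>x. \<bar>\<psi> x\<bar> \<le> 1"
  shows "(LINT x|lborel. indicator E x * (\<psi> (x + a) - \<psi> x)) \<le> norm a * enn2real (perimeter E)"
proof -
  let ?D = "\<lambda>s x. frechet_derivative \<psi> (at (x + s *\<^sub>R a)) a"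
  have cont: "continuous_on UNIV (\<lambda>(s, x). ?D s x)"
    unfolding case_prod_beta
    by (intro continuous_on_compose2[OF Cc_continuous[OF C1c_Cc(2)[OF \<psi>(1)]]] continuous_intros) auto
  have "(LINT x|lborel. indicator E x * (\<psi> (x + a) - \<psi> x))
      = (LINT x|lborel. indicator E x * integral {0..1} (\<lambda>s. ?D s x))"
    by (simp add: integral_derivative_segment[OF \<psi>(1)])
  also have "\<dots> = integral {0..1} (\<lambda>s. LINT x|lborel. indicator E x * ?D s x)"
    using integral_swap_unit_interval(2)[OF cont E] by simp
  also have "\<dots> \<le> integral {0..1::real} (\<lambda>s. norm a * enn2real (perimeter E))"
  proof (rule integral_le[OF integral_swap_unit_interval(1)[OF cont E]])
    fix s :: real
    show "(LINT x|lborel. indicator E x * ?D s x) \<le> norm a * enn2real (perimeter E)"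
      using integral_derivative_le_perimeter[OF E(1) fin C1c_translate[OF \<psi>(1), of "s *\<^sub>R a"], of a] \<psi>(2)
      by (simp add: frechet_derivative_translate[OF \<psi>(1)])
  qed (rule integrable_const_ivl)
  finally show ?thesis by simp
qed

lemma Cc_integrable_indicator:
  assumes "E \<in> sets borel" "Cc f"
  shows "integrable lborel (\<lambda>x. indicator E x * f x)"
  using integrable_mult_indicator[OF _ Cc_integrable[OF assms(2)], of E] assms(1) by simp

text \<open>A C1 function \<open>\<psi>\<close> within \<open>e\<close> of \<open>g\<close> may
  exceed \<open>1\<close> by \<open>e\<close>, so the previous bound is applied to
  \<open>\<psi> / (1 + e)\<close>. Replacing \<open>g\<close> by \<open>\<psi>\<close> costs at most
  \<open>2 * e\<close> times the finite volume of \<open>E\<close>; then \<open>e\<close> tends to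
  \<open>0\<close>.\<close>

lemma integral_increment_le_perimeter:
  fixes E :: "'a::euclidean_space set"
  assumes E: "E \<in> sets borel" "bounded E" and fin: "perimeter E < \<infinity>"
    and g: "Cc g" "\<And>x. \<bar>g x\<bar> \<le> 1"
  shows "(LINT x|lborel. indicator E x * (g (x + a) - g x)) \<le> norm a * enn2real (perimeter E)"
proof -
  let ?p = "norm a * enn2real (perimeter E)" and ?m = "measure lborel E"
  let ?I = "\<lambda>f. LINT x|lborel. indicator E x * (f (x + a) - f x)"
  have Efin: "emeasure lborel E < \<infinity>"
    using E(2) by (rule emeasure_bounded_finite)
  have bd: "?I g \<le> (1 + e) * ?p + 2 * e * ?m" if "0 < e" for e
  proof -
    obtain \<psi> where \<psi>: "C1c \<psi>" "\<And>x. \<bar>\<psi> x - g x\<bar> \<le> e"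
      using C1c_uniformly_dense[OF g(1) \<open>0 < e\<close>] by blast
    have i\<psi>: "integrable lborel (\<lambda>x. indicator E x * (\<psi> (x + a) - \<psi> x))"
      by (intro Cc_integrable_indicator E Cc_diff Cc_translate C1c_Cc \<psi>)
    have iE: "integrable lborel (\<lambda>x. indicator E x * (2 * e))"
      using E Efin by (intro integrable_mult_left) auto
    have "?I g \<le> (LINT x|lborel. indicator E x * (\<psi> (x + a) - \<psi> x) + indicator E x * (2 * e))"
    proof (rule integral_mono)
      show "integrable lborel (\<lambda>x. indicator E x * (g (x + a) - g x))"
        by (intro Cc_integrable_indicator E Cc_diff Cc_translate g)
      show "integrable lborel (\<lambda>x. indicator E x * (\<psi> (x + a) - \<psi> x) + indicator E x * (2 * e))"
        using i\<psi> iE by simp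
      fix x
      have "g (x + a) - g x \<le> (\<psi> (x + a) - \<psi> x) + 2 * e"
        using \<psi>(2)[of x] \<psi>(2)[of "x + a"] by linarith
      then show "indicator E x * (g (x + a) - g x)
          \<le> indicator E x * (\<psi> (x + a) - \<psi> x) + indicator E x * (2 * e)"
        by (simp add: indicator_def)
    qed
    also have "\<dots> = ?I \<psi> + 2 * e * ?m"
      using i\<psi> iE E by (simp add: measure_def)
    also have "?I \<psi> \<le> (1 + e) * ?p"
    proof -
      have "\<bar>\<psi> x\<bar> \<le> 1 + e" for x
        using \<psi>(2)[of x] g(2)[of x] by linarith
      moreover have "C1c (\<lambda>x. \<psi> x / (1 + e))"
      proof -
        obtain R where "\<forall>x. R < norm x \<longrightarrow> \<psi> x = 0"
          using C1c_Cc(1)[OF \<psi>(1)] unfolding Cc_def by blast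
        then show ?thesis
          using C1c_has_derivative[OF \<psi>(1)] Cc_continuous[OF C1c_Cc(2)[OF \<psi>(1)]] \<open>0 < e\<close>
          by (intro C1cI[where D="\<lambda>x h. frechet_derivative \<psi> (at x) h / (1 + e)"])
             (auto simp: divide_inverse intro!: has_derivative_mult_left continuous_intros)
      qed
      ultimately have "?I (\<lambda>x. \<psi> x / (1 + e)) \<le> ?p"
        using \<open>0 < e\<close> by (intro integral_increment_le_perimeter_C1c[OF E fin]) auto
      moreover have "?I (\<lambda>x. \<psi> x / (1 + e)) = ?I \<psi> / (1 + e)"
        by (simp flip: diff_divide_distrib)
      ultimately have "?I \<psi> / (1 + e) \<le> ?p" by simp
      then show ?thesis using \<open>0 < e\<close> by (subst (asm) pos_divide_le_eq) (auto simp: mult.commute)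
    qed
    finally show ?thesis by simp
  qed
  have "((\<lambda>e. (1 + e) * ?p + 2 * e * ?m) \<longlongrightarrow> (1 + 0) * ?p + 2 * 0 * ?m) (at_right 0)"
    by (intro tendsto_intros)
  then show ?thesis
    using bd by (intro tendsto_lowerbound[where F="at_right 0"]) (auto simp: eventually_at_right_less intro!: eventually_at_rightI[of 0 1])
qed

lemma translate_diff_borel:
  fixes E :: "'a::euclidean_space set"
  assumes "closed E"
  shows "{x. x \<notin> E \<and> x - a \<in> E} \<in> sets borel"
proof -
  have "{x. x \<notin> E \<and> x - a \<in> E} = (\<lambda>x. x - a) -` E - E" by auto
  moreover have "closed ((\<lambda>x. x - a) -` E)"
    using assms by (intro closed_vimage continuous_intros)
  ultimately show ?thesis
    using assms by (auto intro: sets.Diff)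
qed

text \<open>Test functions \<open>min 1 (n dist(x,E))\<close> approximate the indicator of the complement of \<open>E\<close>;
  the factor \<open>\<kappa>\<close> makes them compactly supported without changing them on \<open>E + a\<close>.\<close>
lemma emeasure_translate_diff_le_perimeter:
  fixes E :: "'a::euclidean_space set"
  assumes E: "compact E" "E \<noteq> {}"
  shows "emeasure lborel {x. x \<notin> E \<and> x - a \<in> E} \<le> ennreal (norm a) * perimeter E"
\<comment> \<open>For \<open>a = 0\<close> the swept set is empty; for \<open>a \<noteq> 0\<close>
  and infinite perimeter the right-hand side is infinite. Otherwise all quantities can be treated as
  reals.\<close>
proof (cases "a = 0 \<or> perimeter E = \<infinity>")
  case True
  then show ?thesis
  proof
    assume "a = 0"
    then have "{x. x \<notin> E \<and> x - a \<in> E} = {}" by auto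
    then show ?thesis by (metis emeasure_empty zero_le)
  next
    assume "perimeter E = \<infinity>"
    then show ?thesis
      by (cases "a = 0") (auto simp: ennreal_mult_top)
  qed
next
  case False
  then have fin: "perimeter E < \<infinity>" by (auto simp: less_top)
  let ?p = "norm a * enn2real (perimeter E)"
  have cl: "closed E" and bE: "bounded E" and [measurable]: "E \<in> sets borel"
    using E by (auto simp: compact_imp_closed compact_imp_bounded)
  let ?A = "{x. x \<notin> E \<and> x - a \<in> E}"
  have [measurable]: "?A \<in> sets borel"
    using cl by (rule translate_diff_borel)
  have Efin: "emeasure lborel E < \<infinity>"
    using bE by (rule emeasure_bounded_finite)
  define \<kappa> where "\<kappa> = (\<lambda>x. max 0 (1 - infdist x ((+) a ` E)))"
  define \<theta> where "\<theta> = (\<lambda>n x. min 1 (real n * infdist x E))"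
  have \<kappa>: "Cc \<kappa>"
  proof -
    have "bounded ((+) a ` E)" using bE by (rule bounded_translation)
    then obtain R where R: "\<And>y. y \<in> (+) a ` E \<Longrightarrow> norm y \<le> R"
      using bounded_iff by metis
    have "\<kappa> x = 0" if "R + 1 < norm x" for x
    proof -
      have "1 \<le> infdist x ((+) a ` E)"
      proof -
        obtain y where "y \<in> (+) a ` E" "infdist x ((+) a ` E) = dist x y"
          using infdist_attains_inf[of "(+) a ` E" x] E cl closed_translation by blast
        with R[of y] that show ?thesis
          using norm_triangle_ineq2[of x y] by (simp add: dist_norm)
      qed
      then show ?thesis by (simp add: \<kappa>_def)
    qed
    then show ?thesis
      unfolding Cc_def by (auto simp: \<kappa>_def intro!: continuous_intros)
  qed
  have \<theta>c: "continuous_on UNIV (\<theta> n)" for n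
    unfolding \<theta>_def by (intro continuous_intros)
  have \<theta>: "0 \<le> \<theta> n x" "\<theta> n x \<le> 1" for n x
    by (auto simp: \<theta>_def infdist_nonneg)
  have bound: "(LINT x|lborel. indicator E x * \<theta> n (x + a)) \<le> ?p" for n
  proof -
    have "\<bar>\<kappa> x * \<theta> n x\<bar> \<le> 1" for x
      using \<theta>[of n x] by (auto simp: \<kappa>_def abs_mult infdist_nonneg intro!: mult_le_one)
    then have "(LINT x|lborel. indicator E x * (\<kappa> (x + a) * \<theta> n (x + a) - \<kappa> x * \<theta> n x)) \<le> ?p"
      using integral_increment_le_perimeter[OF _ bE fin Cc_mult[OF \<kappa> \<theta>c]] by simp
    \<comment> \<open>For \<open>x \<in> E\<close> the subtracted term vanishes because
      \<open>\<theta> n x = 0\<close>, and \<open>\<kappa> (x + a) = 1\<close>.\<close>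
    moreover have "indicator E x * (\<kappa> (x + a) * \<theta> n (x + a) - \<kappa> x * \<theta> n x) = indicator E x * \<theta> n (x + a)" for x
      by (auto simp: indicator_def \<kappa>_def \<theta>_def add.commute)
    ultimately show ?thesis by simp
  qed
  \<comment> \<open>Since \<open>E\<close> is closed, \<open>\<theta> n\<close> tends to the
    indicator of its complement. The limit is thus the volume of the points of \<open>E\<close> that
    the shift moves out of \<open>E\<close>, which is that of \<open>?A\<close> after
    translation.\<close>
  have "(\<lambda>n. LINT x|lborel. indicator E x * \<theta> n (x + a)) \<longlonglongrightarrow> (LINT x|lborel. indicator ?A (x + a))"
  proof (rule integral_dominated_convergence[where w="indicator E"])
    show "(\<lambda>x. indicator E x * \<theta> n (x + a)) \<in> borel_measurable lborel" for n
      using borel_measurable_continuous_onI[OF \<theta>c[of n]] by measurable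
    show "integrable lborel (indicator E :: 'a \<Rightarrow> real)"
      using Efin by simp
    show "AE x in lborel. (\<lambda>n. indicator E x * \<theta> n (x + a)) \<longlonglongrightarrow> indicator ?A (x + a)"
    proof (rule AE_I2)
      fix x
      show "(\<lambda>n. indicator E x * \<theta> n (x + a)) \<longlonglongrightarrow> indicator ?A (x + a)"
      proof (cases "x \<in> E \<and> x + a \<notin> E")
        case True
        then have "0 < infdist (x + a) E"
          using E cl infdist_nonneg[of "x + a" E] in_closed_iff_infdist_zero[of E "x + a"] by linarith
        then obtain N where N: "1 < real N * infdist (x + a) E"
          using reals_Archimedean3 by blast
        have "\<theta> n (x + a) = 1" if "N \<le> n" for n
        proof -
          have "real N * infdist (x + a) E \<le> real n * infdist (x + a) E"
            using that by (intro mult_right_mono) (auto simp: infdist_nonneg)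
          then show ?thesis using N by (simp add: \<theta>_def)
        qed
        then have "\<forall>\<^sub>F n in sequentially. indicator E x * \<theta> n (x + a) = indicator ?A (x + a)"
          using True by (auto simp: eventually_sequentially intro!: exI[of _ N])
        then show ?thesis by (rule tendsto_eventually)
      next
        case False
        then show ?thesis by (auto simp: indicator_def \<theta>_def)
      qed
    qed
    show "AE x in lborel. norm (indicator E x * \<theta> n (x + a)) \<le> indicator E x" for n
      using \<theta>[of n] by (auto simp: indicator_def)
  qed measurable
  then have "(LINT x|lborel. indicator ?A (x + a)) \<le> ?p"
    by (rule LIMSEQ_le_const2) (use bound in blast)
  then have "measure lborel ?A \<le> ?p"
    using integral_lborel_translate[of "indicator ?A" a] by simp
  moreover have "emeasure lborel ?A < \<infinity>"
  proof (rule emeasure_bounded_finite)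
    have "?A \<subseteq> (+) a ` E" by (force simp: image_iff)
    then show "bounded ?A"
      using bounded_translation[OF bE] bounded_subset by blast
  qed
  ultimately have "emeasure lborel ?A \<le> ennreal ?p"
    by (simp add: emeasure_eq_ennreal_measure less_top ennreal_leI)
  then show ?thesis
    using fin by (simp add: ennreal_mult)
qed

section \<open>Volume of shells and the energy of increments\<close>

text \<open>The filled set is the complement of \<open>outside K\<close>, which for compact
  \<open>K\<close> is open with bounded complement.\<close>

lemma compact_filled:
  fixes K :: "'a::euclidean_space set"
  assumes "compact K"
  shows "compact (filled K)" "K \<subseteq> filled K"
proof -
  have "filled K = - outside K"
  proof -
    have "\<Union>{C. C \<in> components (- K) \<and> \<not> bounded C} = outside K"
    proof (intro subset_antisym subsetI)
      fix x assume "x \<in> \<Union>{C. C \<in> components (- K) \<and> \<not> bounded C}"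
      then obtain C where "C \<in> components (- K)" "\<not> bounded C" "x \<in> C" by blast
      then show "x \<in> outside K"
        by (metis (mono_tags, lifting) components_iff connected_component_eq mem_Collect_eq outside)
    next
      fix x assume "x \<in> outside K"
      then have "x \<in> - K" "\<not> bounded (connected_component_set (- K) x)"
        by (auto simp: outside_def)
      then show "x \<in> \<Union>{C. C \<in> components (- K) \<and> \<not> bounded C}"
        using componentsI[of x "- K"] connected_component_refl[of x "- K"] by blast
    qed
    then show ?thesis by (simp add: filled_def)
  qed
  moreover have "K \<subseteq> - outside K"
    using outside_no_overlap[of K] by blast
  ultimately show "compact (filled K)" "K \<subseteq> filled K"
    using assms cobounded_outside[of K] open_outside[of K]
    by (simp_all add: compact_eq_bounded_closed closed_Compl)
qed

lemma compact_nbhd: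
  fixes F :: "'a::euclidean_space set"
  assumes "compact F" "F \<noteq> {}"
  shows "compact (nbhd F t)"
proof -
  obtain M where M: "\<And>y. y \<in> F \<Longrightarrow> norm y \<le> M"
    using compact_imp_bounded[OF assms(1)] bounded_iff by metis
  have "norm x \<le> M + t" if "infdist x F \<le> t" for x
  proof -
    obtain y where "y \<in> F" "infdist x F = dist x y"
      using infdist_attains_inf[of F x] assms compact_imp_closed by blast
    then show ?thesis
      using that M[of y] norm_triangle_ineq2[of x y] by (simp add: dist_norm)
  qed
  then have "bounded (nbhd F t)"
    unfolding bounded_iff nbhd_def by blast
  moreover have "closed (nbhd F t)"
    unfolding nbhd_def by (intro closed_Collect_le continuous_intros)
  ultimately show ?thesis by (simp add: compact_eq_bounded_closed)
qed

text \<open>A point at distance between \<open>t\<close> and \<open>t + r\<close> from \<open>F\<close> enters the ball of radius \<open>t\<close> about its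
  nearest point of \<open>F\<close> when moved by \<open>2 n r\<close> against the coordinate direction that is most aligned
  with the outward direction, whose cosine is at least \<open>1/n\<close>.\<close>
lemma emeasure_shell_le_perimeter:
  fixes F :: "'a::euclidean_space set"
  assumes F: "compact F" "F \<noteq> {}" and t: "0 < t" and r: "0 < r" "2 * (real DIM('a))\<^sup>2 * r \<le> t"
  shows "emeasure lborel {x. t < infdist x F \<and> infdist x F \<le> t + r}
       \<le> ennreal (4 * (real DIM('a))\<^sup>2 * r) * perimeter (nbhd F t)"
proof -
  define n where "n = real DIM('a)"
  \<comment> \<open>With cosine at least \<open>1/n\<close>, a shift by \<open>2 * n * r\<close>
    lowers the squared distance \<open>\<rho>\<^sup>2\<close> by at least
    \<open>4 * r * \<rho> - \<tau>\<^sup>2\<close>, enough to reach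
    \<open>t\<^sup>2\<close>.\<close>
  define \<tau> where "\<tau> = 2 * n * r"
  have n: "1 \<le> n" unfolding n_def using DIM_positive[where 'a='a] by linarith
  let ?E = "nbhd F t"
  let ?B = "Basis \<union> uminus ` Basis :: 'a set"
  let ?S = "\<lambda>e. {x. x \<notin> ?E \<and> x - \<tau> *\<^sub>R e \<in> ?E}"
  have E: "compact ?E" "?E \<noteq> {}"
  proof -
    obtain z where "z \<in> F" using F by blast
    then have "z \<in> ?E" using t by (simp add: nbhd_def)
    then show "?E \<noteq> {}" by blast
  qed (rule compact_nbhd[OF F])
  have sub: "{x. t < infdist x F \<and> infdist x F \<le> t + r} \<subseteq> (\<Union>e\<in>?B. ?S e)"
  proof safe
    fix x assume x: "t < infdist x F" "infdist x F \<le> t + r"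
    obtain y where y: "y \<in> F" "infdist x F = dist x y"
      using infdist_attains_inf[of F x] F compact_imp_closed by blast
    define \<rho> where "\<rho> = norm (x - y)"
    have \<rho>: "t < \<rho>" "\<rho> \<le> t + r" using x y by (auto simp: \<rho>_def dist_norm)
    \<comment> \<open>Otherwise the sum of the absolute coordinates of \<open>x - y\<close> would be
      smaller than its Euclidean norm.\<close>
    have "\<exists>i\<in>Basis. \<rho> \<le> n * \<bar>(x - y) \<bullet> i\<bar>"
    proof (rule ccontr)
      assume "\<not> (\<exists>i\<in>Basis. \<rho> \<le> n * \<bar>(x - y) \<bullet> i\<bar>)"
      then have "(\<Sum>i\<in>Basis. n * \<bar>(x - y) \<bullet> i\<bar>) < (\<Sum>i\<in>(Basis::'a set). \<rho>)"
        by (intro sum_strict_mono) (auto simp: not_le)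
      also have "\<dots> = n * \<rho>" by (simp add: n_def)
      finally have "(\<Sum>i\<in>Basis. \<bar>(x - y) \<bullet> i\<bar>) < \<rho>"
        using n by (simp flip: sum_distrib_left)
      then show False using norm_le_l1[of "x - y"] by (simp add: \<rho>_def)
    qed
    then obtain i where i: "i \<in> Basis" "\<rho> \<le> n * \<bar>(x - y) \<bullet> i\<bar>" by blast
    define e where "e = (if 0 \<le> (x - y) \<bullet> i then i else - i)"
    have e: "e \<in> ?B" "norm e = 1" "\<rho> \<le> n * ((x - y) \<bullet> e)"
      using i by (auto simp: e_def)
    have "(norm (x - \<tau> *\<^sub>R e - y))\<^sup>2 = \<rho>\<^sup>2 - 2 * \<tau> * ((x - y) \<bullet> e) + \<tau>\<^sup>2"
    proof -
      have "x - \<tau> *\<^sub>R e - y = (x - y) - \<tau> *\<^sub>R e" by simp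
      then show ?thesis
        using e(2) by (simp only: \<rho>_def power2_norm_eq_inner inner_diff_left[of "x - y"] inner_diff_right[of _ "x - y"])
          (simp add: inner_commute power2_eq_square norm_eq_1)
    qed
    also have "2 * \<tau> * ((x - y) \<bullet> e) = 4 * r * (n * ((x - y) \<bullet> e))" by (simp add: \<tau>_def)
    also have "\<rho>\<^sup>2 - 4 * r * (n * ((x - y) \<bullet> e)) + \<tau>\<^sup>2 \<le> \<rho>\<^sup>2 - 4 * r * \<rho> + \<tau>\<^sup>2"
      using e(3) r by simp
    \<comment> \<open>Of the gain \<open>4 * r * \<rho>\<close>, one half pays for
      \<open>\<rho>\<^sup>2 - t\<^sup>2\<close> and the other for \<open>\<tau>\<^sup>2\<close>; the
      latter is where \<open>r\<close> has to be small relative to \<open>t\<close>.\<close>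
    also have "\<rho>\<^sup>2 - 4 * r * \<rho> + \<tau>\<^sup>2 \<le> t\<^sup>2"
    proof -
      have "(\<rho> - t) * (\<rho> + t) \<le> r * (2 * \<rho>)"
        using \<rho> t r by (intro mult_mono) auto
      moreover have "\<tau>\<^sup>2 = 2 * r * (2 * n\<^sup>2 * r)"
        by (simp add: \<tau>_def power2_eq_square)
      moreover have "2 * r * (2 * n\<^sup>2 * r) \<le> 2 * r * \<rho>"
        using r \<rho> by (intro mult_left_mono) (auto simp: n_def)
      ultimately show ?thesis
        by (simp add: power2_eq_square algebra_simps)
    qed
    finally have "norm (x - \<tau> *\<^sub>R e - y) \<le> t"
      using t by (simp add: power2_le_iff_abs_le)
    then have "x - \<tau> *\<^sub>R e \<in> ?E"
      using infdist_le[OF y(1), of "x - \<tau> *\<^sub>R e"] by (simp add: nbhd_def dist_norm)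
    moreover have "x \<notin> ?E" using x by (simp add: nbhd_def)
    ultimately show "x \<in> (\<Union>e\<in>?B. ?S e)" using e(1) by blast
  qed
  have Sm: "?S e \<in> sets borel" for e
    using compact_imp_closed[OF E(1)] by (rule translate_diff_borel)
  have "emeasure lborel {x. t < infdist x F \<and> infdist x F \<le> t + r} \<le> emeasure lborel (\<Union>e\<in>?B. ?S e)"
    by (intro emeasure_mono sub sets.finite_UN) (use Sm in simp_all)
  also have "\<dots> \<le> (\<Sum>e\<in>?B. emeasure lborel (?S e))"
    using Sm by (intro emeasure_subadditive_finite) auto
  also have "\<dots> \<le> (\<Sum>e\<in>?B. ennreal \<tau> * perimeter ?E)"
  proof (rule sum_mono)
    fix e assume "e \<in> ?B"
    then have "norm (\<tau> *\<^sub>R e) = \<tau>" using n r by (auto simp: \<tau>_def)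
    then show "emeasure lborel (?S e) \<le> ennreal \<tau> * perimeter ?E"
      using emeasure_translate_diff_le_perimeter[OF E, of "\<tau> *\<^sub>R e"] by simp
  qed
  also have "\<dots> = of_nat (card ?B) * (ennreal \<tau> * perimeter ?E)" by simp
  \<comment> \<open>At most \<open>2 * n\<close> signed directions, each sweeping at most
    \<open>\<tau> = 2 * n * r\<close> times the perimeter, give the factor
    \<open>4 * n\<^sup>2 * r\<close>.\<close>
  also have "\<dots> \<le> of_nat (2 * DIM('a)) * (ennreal \<tau> * perimeter ?E)"
  proof (rule mult_right_mono)
    have "card ?B \<le> DIM('a) + card (uminus ` Basis :: 'a set)" by (rule card_Un_le)
    also have "\<dots> \<le> 2 * DIM('a)" using card_image_le[of "Basis :: 'a set" uminus] by simp
    finally show "of_nat (card ?B) \<le> (of_nat (2 * DIM('a)) :: ennreal)" by (rule of_nat_mono)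
  qed simp
  also have "\<dots> = ennreal (4 * n\<^sup>2 * r) * perimeter ?E"
  proof -
    have "of_nat (2 * DIM('a)) = ennreal (2 * n)"
      using ennreal_of_nat_eq_real_of_nat[of "2 * DIM('a)"] by (simp add: n_def)
    moreover have "ennreal (2 * n) * ennreal \<tau> = ennreal (4 * n\<^sup>2 * r)"
      using n r by (subst ennreal_mult[symmetric]) (auto simp: \<tau>_def power2_eq_square)
    ultimately show ?thesis by (metis mult.assoc)
  qed
  finally show ?thesis by (simp add: n_def)
qed


section \<open>One-dimensional integrals and the energy of increments\<close>

lemma integrable_bounded_support:
  fixes h :: "real \<Rightarrow> real"
  assumes [measurable]: "h \<in> borel_measurable borel" and "\<And>t. \<bar>h t\<bar> \<le> B"
    and "\<And>t. h t \<noteq> 0 \<Longrightarrow> s < t \<and> t \<le> R"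
  shows "integrable lborel h"
proof (rule Bochner_Integration.integrable_bound)
  show "integrable lborel (\<lambda>t. indicator {s..R} t * B)"
    by (cases "s \<le> R") (auto intro!: integrable_mult_left)
  show "AE t in lborel. norm (h t) \<le> norm (indicator {s..R} t * B)"
  proof (rule AE_I2)
    fix t
    show "norm (h t) \<le> norm (indicator {s..R} t * B)"
      using assms(2)[of t] assms(3)[of t] by (cases "h t = 0") (auto simp: less_imp_le)
  qed
qed simp

text \<open>Expand the integral of \<open>(h t - l)\<^sup>2 \<ge> 0\<close> over the interval, with
  \<open>l\<close> the mean value of \<open>h\<close>; the degenerate interval is split off so that
  the mean makes sense.\<close>

lemma Cauchy_Schwarz_interval:
  fixes h :: "real \<Rightarrow> real"
  assumes "integrable lborel h" "integrable lborel (\<lambda>t. (h t)\<^sup>2)" "a \<le> c"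
  shows "(LINT t|lborel. indicator {a..<c} t * h t)\<^sup>2 \<le> (c - a) * (LINT t|lborel. indicator {a..<c} t * (h t)\<^sup>2)"
proof (cases "a = c")
  case False
  let ?J = "LINT t|lborel. indicator {a..<c} t * h t"
  let ?Q = "LINT t|lborel. indicator {a..<c} t * (h t)\<^sup>2"
  define l where "l = ?J / (c - a)"
  have i1: "integrable lborel (\<lambda>t. indicator {a..<c} t * h t)"
    using integrable_mult_indicator[OF _ assms(1), of "{a..<c}"] by simp
  have i2: "integrable lborel (\<lambda>t. indicator {a..<c} t * (h t)\<^sup>2)"
    using integrable_mult_indicator[OF _ assms(2), of "{a..<c}"] by simp
  have i3: "integrable lborel (indicator {a..<c} :: real \<Rightarrow> real)"
    using assms(3) by simp
  have "0 \<le> (LINT t|lborel. indicator {a..<c} t * (h t - l)\<^sup>2)"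
    by (intro integral_nonneg_AE) auto
  also have "(\<lambda>t. indicator {a..<c} t * (h t - l)\<^sup>2) = (\<lambda>t. indicator {a..<c} t * (h t)\<^sup>2
      - 2 * l * (indicator {a..<c} t * h t) + l\<^sup>2 * indicator {a..<c} t)"
    by (auto simp: fun_eq_iff power2_eq_square algebra_simps)
  also have "(LINT t|lborel. \<dots> t) = ?Q - 2 * l * ?J + l\<^sup>2 * (c - a)"
    using i1 i2 i3 assms(3) by simp
  finally have pos: "0 \<le> ?Q - 2 * l * ?J + l\<^sup>2 * (c - a)" .
  have J: "?J = l * (c - a)" using False by (simp add: l_def)
  have "0 \<le> (c - a) * (?Q - 2 * l * ?J + l\<^sup>2 * (c - a))"
    using pos assms(3) by (intro mult_nonneg_nonneg) auto
  then show ?thesis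
    unfolding J by (simp add: power2_eq_square algebra_simps)
qed simp

text \<open>The test function is \<open>x \<mapsto> H (infdist x F)\<close> with \<open>H a = \<integral>\<^sub>a h\<close>. By the Cauchy--Schwarz inequality a
  squared increment of it is at most \<open>\<epsilon>\<close> times the integral of \<open>h\<^sup>2\<close> over the levels \<open>t\<close> between the two
  distances, and each such \<open>t\<close> is at most \<open>\<epsilon>\<close> below the larger of them.\<close>
lemma increment_energy_le:
  fixes F :: "'a::euclidean_space set" and h :: "real \<Rightarrow> real"
  assumes F: "compact F" "F \<noteq> {}"
    and h [measurable]: "h \<in> borel_measurable borel" and h0: "\<And>t. 0 \<le> h t" and hB: "\<And>t. h t \<le> B"
    and hs: "\<And>t. h t \<noteq> 0 \<Longrightarrow> s < t \<and> t \<le> R" and s: "0 < s"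
    and hP: "\<And>t. ennreal (h t) * perimeter (nbhd F t) \<le> 1"
    and \<epsilon>: "0 < \<epsilon>" "2 * (real DIM('a))\<^sup>2 * \<epsilon> \<le> s"
    and b: "norm b \<le> \<epsilon>"
    and H: "\<And>a. H a = (LINT t|lborel. indicator {a..} t * h t)"
  shows "(\<integral>\<^sup>+ x. ennreal ((H (infdist (x + b) F) - H (infdist x F))\<^sup>2) \<partial>lborel)
     \<le> ennreal (8 * (real DIM('a))\<^sup>2 * \<epsilon>\<^sup>2 * (LINT t|lborel. h t))"
proof -
  let ?d = "\<lambda>x. infdist x F"
  define C where "C = 4 * (real DIM('a))\<^sup>2"
  have hint: "integrable lborel h"
    using h0 hB hs by (intro integrable_bounded_support[of h B s R]) auto
  have h2int: "integrable lborel (\<lambda>t. (h t)\<^sup>2)"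
    using h0 hB hs by (intro integrable_bounded_support[of _ "B\<^sup>2" s R]) (auto intro!: power_mono)
  \<comment> \<open>For fixed \<open>x\<close> this restricts \<open>h\<^sup>2\<close> to the levels
    at most \<open>\<epsilon>\<close> below \<open>?d x\<close>; for fixed \<open>t\<close> it
    restricts \<open>x\<close> to a shell of thickness \<open>\<epsilon>\<close>.\<close>
  let ?f = "\<lambda>x t. ennreal ((h t)\<^sup>2) * (if t < ?d x \<and> ?d x \<le> t + \<epsilon> then 1 else 0)"
  let ?I = "\<lambda>x. \<integral>\<^sup>+ t. ?f x t \<partial>lborel"
  have cs: "ennreal ((H a - H c)\<^sup>2)
      \<le> ennreal \<epsilon> * (\<integral>\<^sup>+ t. ennreal ((h t)\<^sup>2) * (if t < c \<and> c \<le> t + \<epsilon> then 1 else 0) \<partial>lborel)"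
    if "a \<le> c" "c \<le> a + \<epsilon>" for a c
  proof -
    let ?Q = "LINT t|lborel. indicator {a..<c} t * (h t)\<^sup>2"
    have i: "integrable lborel (\<lambda>t. indicator A t * h t)" if "A \<in> sets borel" for A
      using integrable_mult_indicator[OF _ hint, of A] that by simp
    have i2: "integrable lborel (\<lambda>t. indicator {a..<c} t * (h t)\<^sup>2)"
      using integrable_mult_indicator[OF _ h2int, of "{a..<c}"] by simp
    have "H a - H c = (LINT t|lborel. indicator {a..} t * h t - indicator {c..} t * h t)"
      unfolding H by (intro Bochner_Integration.integral_diff[symmetric] i) auto
    also have "\<dots> = (LINT t|lborel. indicator {a..<c} t * h t)"
      using that(1) by (intro Bochner_Integration.integral_cong) (auto simp: indicator_def)
    finally have "(H a - H c)\<^sup>2 \<le> (c - a) * ?Q"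
      using Cauchy_Schwarz_interval[OF hint h2int that(1)] by simp
    also have "\<dots> \<le> \<epsilon> * ?Q"
      using that by (intro mult_right_mono integral_nonneg_AE) auto
    finally have "ennreal ((H a - H c)\<^sup>2) \<le> ennreal (\<epsilon> * ?Q)"
      by (rule ennreal_leI)
    also have "\<dots> = ennreal \<epsilon> * (\<integral>\<^sup>+ t. ennreal (indicator {a..<c} t * (h t)\<^sup>2) \<partial>lborel)"
      using \<epsilon>(1) i2 by (subst nn_integral_eq_integral) (auto simp: ennreal_mult)
    \<comment> \<open>If \<open>a \<le> t < c\<close> then
      \<open>c \<le> a + \<epsilon> \<le> t + \<epsilon>\<close>, so the new window depends on the
      larger level \<open>c\<close> only.\<close>
    also have "\<dots> \<le> ennreal \<epsilon> * (\<integral>\<^sup>+ t. ennreal ((h t)\<^sup>2) * (if t < c \<and> c \<le> t + \<epsilon> then 1 else 0) \<partial>lborel)"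
      using that by (intro mult_left_mono nn_integral_mono) (auto simp: indicator_def)
    finally show ?thesis .
  qed
  have dd: "\<bar>?d (x + b) - ?d x\<bar> \<le> \<epsilon>" for x
    using infdist_triangle_abs[of "x + b" F x] b by (simp add: dist_norm)
  \<comment> \<open>The window belongs to whichever of \<open>x\<close> and \<open>x + b\<close> is
    farther from \<open>F\<close>; summing over both points covers the two cases.\<close>
  have pw: "ennreal ((H (?d (x + b)) - H (?d x))\<^sup>2) \<le> ennreal \<epsilon> * (?I (x + b) + ?I x)" for x
  proof (cases "?d x \<le> ?d (x + b)")
    case True
    then have "ennreal ((H (?d x) - H (?d (x + b)))\<^sup>2) \<le> ennreal \<epsilon> * ?I (x + b)"
      using dd[of x] by (intro cs) auto
    also have "\<dots> \<le> ennreal \<epsilon> * (?I (x + b) + ?I x)"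
      by (intro mult_left_mono) auto
    finally show ?thesis by (simp add: power2_commute)
  next
    case False
    then have "ennreal ((H (?d (x + b)) - H (?d x))\<^sup>2) \<le> ennreal \<epsilon> * ?I x"
      using dd[of x] by (intro cs) auto
    also have "\<dots> \<le> ennreal \<epsilon> * (?I (x + b) + ?I x)"
      by (intro mult_left_mono) auto
    finally show ?thesis .
  qed
  have dm [measurable]: "?d \<in> borel_measurable borel"
    by (intro borel_measurable_continuous_onI continuous_intros)
  have fm [measurable]: "(\<lambda>(x, t). ?f x t) \<in> borel_measurable (borel \<Otimes>\<^sub>M borel)"
    by measurable
  have fm' [measurable]: "(\<lambda>(x, t). ?f x t) \<in> borel_measurable (lborel \<Otimes>\<^sub>M lborel)"
    using fm by (simp cong: measurable_cong_sets sets_pair_measure_cong)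
  have Im [measurable]: "?I \<in> borel_measurable borel"
    by measurable
  \<comment> \<open>The shell bound yields \<open>h\<^sup>2\<close> times the perimeter, and one
    factor \<open>h\<close> cancels the perimeter by \<open>hP\<close>. This happens for each fixed
    \<open>t\<close>, before integrating over the levels.\<close>
  have level: "(\<integral>\<^sup>+ x. ?f x t \<partial>lborel) \<le> ennreal (C * \<epsilon>) * ennreal (h t)" for t
  proof (cases "h t = 0")
    case False
    then have t: "0 < t" "2 * (real DIM('a))\<^sup>2 * \<epsilon> \<le> t"
      using hs[of t] s \<epsilon>(2) by auto
    let ?A = "{x. t < ?d x \<and> ?d x \<le> t + \<epsilon>}"
    have [measurable]: "?A \<in> sets borel" by measurable
    have "(\<integral>\<^sup>+ x. ?f x t \<partial>lborel) = (\<integral>\<^sup>+ x. ennreal ((h t)\<^sup>2) * indicator ?A x \<partial>lborel)"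
      by (intro nn_integral_cong) (auto simp: indicator_def)
    also have "\<dots> = ennreal ((h t)\<^sup>2) * emeasure lborel ?A"
      by (intro nn_integral_cmult_indicator) auto
    also have "\<dots> \<le> ennreal ((h t)\<^sup>2) * (ennreal (C * \<epsilon>) * perimeter (nbhd F t))"
      using emeasure_shell_le_perimeter[OF F t(1) \<epsilon>(1) t(2)] by (intro mult_left_mono) (auto simp: C_def)
    also have "\<dots> = ennreal (C * \<epsilon>) * ennreal (h t) * (ennreal (h t) * perimeter (nbhd F t))"
      using h0[of t] by (simp add: power2_eq_square ennreal_mult mult_ac)
    also have "\<dots> \<le> ennreal (C * \<epsilon>) * ennreal (h t) * 1"
      using hP by (intro mult_left_mono) auto
    finally show ?thesis by simp
  qed simp
  have "(\<integral>\<^sup>+ x. ?I x \<partial>lborel) = (\<integral>\<^sup>+ t. \<integral>\<^sup>+ x. ?f x t \<partial>lborel \<partial>lborel)"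
    by (rule lborel_pair.Fubini'[symmetric]) (rule fm')
  also have "\<dots> \<le> (\<integral>\<^sup>+ t. ennreal (C * \<epsilon>) * ennreal (h t) \<partial>lborel)"
    by (intro nn_integral_mono level)
  also have "\<dots> = ennreal (C * \<epsilon> * (LINT t|lborel. h t))"
    using h0 hint \<epsilon>(1)
    by (subst nn_integral_cmult) (auto simp: nn_integral_eq_integral C_def ennreal_mult integral_nonneg_AE)
  finally have I: "(\<integral>\<^sup>+ x. ?I x \<partial>lborel) \<le> ennreal (C * \<epsilon> * (LINT t|lborel. h t))" .
  have "(\<integral>\<^sup>+ x. ennreal ((H (?d (x + b)) - H (?d x))\<^sup>2) \<partial>lborel)
      \<le> (\<integral>\<^sup>+ x. ennreal \<epsilon> * (?I (x + b) + ?I x) \<partial>lborel)"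
    by (intro nn_integral_mono pw)
  also have "\<dots> = ennreal \<epsilon> * ((\<integral>\<^sup>+ x. ?I (x + b) \<partial>lborel) + (\<integral>\<^sup>+ x. ?I x \<partial>lborel))"
    using Im by (subst nn_integral_cmult) (auto intro!: arg_cong2[where f=times] nn_integral_add)
  also have "(\<integral>\<^sup>+ x. ?I (x + b) \<partial>lborel) = (\<integral>\<^sup>+ x. ?I x \<partial>lborel)"
    by (rule nn_integral_lborel_translate[OF Im])
  \<comment> \<open>The two points contribute equally, so the constant
    \<open>C = 4 n\<^sup>2\<close> doubles; one factor \<open>\<epsilon>\<close> comes from
    Cauchy--Schwarz and one from the shell thickness.\<close>
  also have "ennreal \<epsilon> * ((\<integral>\<^sup>+ x. ?I x \<partial>lborel) + (\<integral>\<^sup>+ x. ?I x \<partial>lborel))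
      \<le> ennreal \<epsilon> * (ennreal (C * \<epsilon> * (LINT t|lborel. h t)) + ennreal (C * \<epsilon> * (LINT t|lborel. h t)))"
    by (intro mult_left_mono add_mono I) auto
  also have "\<dots> = ennreal (8 * (real DIM('a))\<^sup>2 * \<epsilon>\<^sup>2 * (LINT t|lborel. h t))"
    using h0 \<epsilon>(1)
    by (simp add: C_def integral_nonneg_AE power2_eq_square algebra_simps flip: ennreal_plus ennreal_mult)
  finally show ?thesis .
qed

section \<open>Mollification and the capacity bound\<close>

lemma seg_avg_increment:
  assumes "Cc v"
  shows "(seg_avg a v (x + b) - seg_avg a v x) / \<epsilon> = seg_avg a (\<lambda>x. (v (x + b) - v x) / \<epsilon>) x"
proof -
  have "seg_avg a v (x + b) - seg_avg a v x = integral {0..1} (\<lambda>s. v (x + b + s *\<^sub>R a) - v (x + s *\<^sub>R a))"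
    unfolding seg_avg_def
    by (intro Henstock_Kurzweil_Integration.integral_diff[symmetric] segment_integrable Cc_continuous assms)
  then show ?thesis
    by (simp add: seg_avg_def add_ac)
qed

text \<open>Induction over the directions already averaged. A new average creates one weak
  derivative, namely a difference quotient, and averages the existing ones; Jensen's inequality
  keeps all bounds. The invariant bounds the quotients in every basis direction, since those not yet
  treated become derivatives later. Each average shrinks the region where the function is known to
  be at least \<open>1\<close> by \<open>\<epsilon>\<close>.\<close>

lemma mollification_exists:
  fixes u :: "'a::euclidean_space \<Rightarrow> real"
  assumes u: "Cc u" "\<And>x. 0 \<le> u x" "\<And>x. x \<in> U \<Longrightarrow> 1 \<le> u x" and \<epsilon>: "0 < \<epsilon>"
    and B: "\<And>j. j \<in> Basis \<Longrightarrow> (LINT x|lborel. ((u (x + \<epsilon> *\<^sub>R j) - u x) / \<epsilon>)\<^sup>2) \<le> B"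
    and S: "finite S" "S \<subseteq> Basis"
  shows "\<exists>v g. Cc v \<and> (\<forall>x. 0 \<le> v x) \<and> (\<forall>x. cball x (real (card S) * \<epsilon>) \<subseteq> U \<longrightarrow> 1 \<le> v x)
      \<and> (\<forall>j\<in>Basis. (LINT x|lborel. ((v (x + \<epsilon> *\<^sub>R j) - v x) / \<epsilon>)\<^sup>2) \<le> B)
      \<and> (\<forall>j\<in>S. Cc (g j) \<and> weak_partial j v (g j) \<and> (LINT x|lborel. (g j x)\<^sup>2) \<le> B)"
  using S
proof (induction S rule: finite_induct)
  case empty
  show ?case using u B by (intro exI[of _ u]) auto
next
  case (insert i S)
  then obtain v g where v: "Cc v" "\<forall>x. 0 \<le> v x" "\<forall>x. cball x (real (card S) * \<epsilon>) \<subseteq> U \<longrightarrow> 1 \<le> v x"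
      and vB: "\<forall>j\<in>Basis. (LINT x|lborel. ((v (x + \<epsilon> *\<^sub>R j) - v x) / \<epsilon>)\<^sup>2) \<le> B"
      and g: "\<forall>j\<in>S. Cc (g j) \<and> weak_partial j v (g j) \<and> (LINT x|lborel. (g j x)\<^sup>2) \<le> B"
    by auto
  have i: "i \<in> Basis" using insert by simp
  let ?a = "\<epsilon> *\<^sub>R i"
  let ?v = "seg_avg ?a v"
  let ?D = "\<lambda>j x. (v (x + \<epsilon> *\<^sub>R j) - v x) / \<epsilon>"
  \<comment> \<open>The new derivative in direction \<open>i\<close> is the quotient of
    \<open>v\<close> before this averaging step.\<close>
  define g' where "g' = (\<lambda>j. if j = i then ?D i else seg_avg ?a (g j))"
  have D: "Cc (?D j)" for j
    by (intro Cc_divide Cc_diff Cc_translate v)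
  have ii: "(\<lambda>s. v (x + s *\<^sub>R ?a)) integrable_on {0..1}" for x
    by (intro segment_integrable Cc_continuous v)
  have "1 \<le> ?v x" if "cball x (real (card (insert i S)) * \<epsilon>) \<subseteq> U" for x
  proof -
    have "1 \<le> v (x + s *\<^sub>R ?a)" if s: "s \<in> {0..1}" for s
    proof -
      have "norm (s *\<^sub>R ?a) \<le> \<epsilon>"
        using s i \<epsilon> by (simp add: mult_left_le_one_le)
      then have "cball (x + s *\<^sub>R ?a) (real (card S) * \<epsilon>) \<subseteq> cball x (real (card (insert i S)) * \<epsilon>)"
        using insert by (simp add: cball_subset_cball_iff dist_norm algebra_simps)
      then show ?thesis using v(3) \<open>cball x _ \<subseteq> U\<close> by blast
    qed
    then have "integral {0..1::real} (\<lambda>s. 1) \<le> ?v x"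
      unfolding seg_avg_def by (intro integral_le ii) auto
    then show ?thesis by simp
  qed
  moreover have "\<forall>x. 0 \<le> ?v x"
    unfolding seg_avg_def using v(2) by (intro allI Henstock_Kurzweil_Integration.integral_nonneg ii) auto
  moreover have "(LINT x|lborel. ((?v (x + \<epsilon> *\<^sub>R j) - ?v x) / \<epsilon>)\<^sup>2) \<le> B" if "j \<in> Basis" for j
    using integral_seg_avg_power2_le[OF D, of ?a j] vB that
    by (simp add: seg_avg_increment[OF v(1)]) force
  moreover have "Cc (g' j) \<and> weak_partial j ?v (g' j) \<and> (LINT x|lborel. (g' j x)\<^sup>2) \<le> B"
    if "j \<in> insert i S" for j
  proof (cases "j = i")
    case True
    then show ?thesis
      using D weak_partial_seg_avg_self[OF v(1), of \<epsilon> i] vB i \<epsilon> by (auto simp: g'_def)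
  next
    case False
    then have "Cc (g j)" "weak_partial j v (g j)" "(LINT x|lborel. (g j x)\<^sup>2) \<le> B"
      using g that by auto
    then show ?thesis
      using False Cc_seg_avg[of "g j" ?a] weak_partial_seg_avg[OF v(1), of "g j" j ?a]
        integral_seg_avg_power2_le[of "g j" ?a]
      by (auto simp: g'_def)
  qed
  ultimately show ?case
    using Cc_seg_avg[OF v(1), of ?a] by (intro exI[of _ ?v] exI[of _ g']) auto
qed

section \<open>Capacity bounds from explicit competitors\<close>

text \<open>The partial derivatives are assembled into a vector field \<open>G\<close>, whose energy
  is the sum of the \<open>DIM('a)\<close> partial energies. Continuity and bounded support place
  \<open>v\<close> in the admissible class.\<close>

lemma newton_cap_le:
  fixes K :: "'a::euclidean_space set"
  assumes v: "Cc v" "\<And>x. indicator K x \<le> v x"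
    and g: "\<And>j. j \<in> Basis \<Longrightarrow> Cc (g j) \<and> weak_partial j v (g j) \<and> (LINT x|lborel. (g j x)\<^sup>2) \<le> B"
  shows "newton_cap K \<le> ereal (real DIM('a) * B)"
proof -
  define G where "G = (\<lambda>x. \<Sum>j\<in>Basis. g j x *\<^sub>R (j :: 'a))"
  have Gi: "G x \<bullet> i = g i x" if "i \<in> Basis" for i x
    using that by (simp add: G_def inner_sum_left inner_Basis if_distrib cong: if_cong)
  have Gn: "(norm (G x))\<^sup>2 = (\<Sum>j\<in>Basis. (g j x)\<^sup>2)" for x
    unfolding power2_norm_eq_inner by (subst euclidean_inner) (simp add: Gi power2_eq_square)
  have cG: "continuous_on UNIV G"
    unfolding G_def using g by (intro continuous_intros) (auto intro: Cc_continuous)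
  have [measurable]: "G \<in> borel_measurable borel" "v \<in> borel_measurable borel"
    using cG v(1) by (auto intro: borel_measurable_continuous_onI Cc_continuous)
  have lb: "(LINT x|lebesgue. f x) = (LINT x|lborel. f x)" if "f \<in> borel_measurable borel" for f :: "'a \<Rightarrow> real"
    using that by (intro integral_completion) simp
  have int: "integrable lborel (\<lambda>x. (norm (G x))\<^sup>2)"
    unfolding Gn using g by (intro Bochner_Integration.integrable_sum Cc_integrable Cc_power2) auto
  have "weak_gradient v G"
    unfolding weak_gradient_def
  proof (intro conjI allI impI ballI)
    show "G \<in> borel_measurable lebesgue"
      by (rule measurable_completion) simp
    fix \<phi> :: "'a \<Rightarrow> real" and i :: 'a assume \<phi>: "C1c \<phi>" and i: "i \<in> Basis"
    have [measurable]: "\<phi> \<in> borel_measurable borel" "(\<lambda>x. frechet_derivative \<phi> (at x) i) \<in> borel_measurable borel"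
        "g i \<in> borel_measurable borel"
      using C1c_Cc[OF \<phi>] g[OF i] by (auto intro: borel_measurable_continuous_onI Cc_continuous)
    show "(LINT x|lebesgue. v x * frechet_derivative \<phi> (at x) i) = - (LINT x|lebesgue. (G x \<bullet> i) * \<phi> x)"
      using g[OF i] \<phi> by (simp add: lb Gi[OF i] weak_partial_def)
  qed
  moreover have "v \<in> borel_measurable lebesgue"
    by (rule measurable_completion) simp
  moreover have "set_integrable lebesgue C v" if "compact C" for C
  proof -
    have "integrable lebesgue v"
      using Cc_integrable[OF v(1)] by (subst integrable_completion) auto
    then show ?thesis
      using that integrable_mult_indicator[of C lebesgue v]
      by (simp add: set_integrable_def lmeasurable_compact fmeasurableD)
  qed
  moreover have "integrable lebesgue (\<lambda>x. (norm (G x))\<^sup>2)"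
    using int by (subst integrable_completion) auto
  moreover have "emeasure lebesgue {x. \<bar>v x\<bar> > \<epsilon>} < \<infinity>" if "\<epsilon> > 0" for \<epsilon>
  proof -
    obtain R where "\<forall>x. R < norm x \<longrightarrow> v x = 0" using v(1) unfolding Cc_def by blast
    then have "{x. \<bar>v x\<bar> > \<epsilon>} \<subseteq> cball 0 R" using that by (force simp: not_less)
    then have "bounded {x. \<bar>v x\<bar> > \<epsilon>}" using bounded_cball bounded_subset by blast
    moreover have "{x. \<bar>v x\<bar> > \<epsilon>} \<in> sets lborel" by measurable
    ultimately show ?thesis using emeasure_bounded_finite by (simp add: emeasure_completion)
  qed
  ultimately have "D1_with_grad v G" by (auto simp: D1_with_grad_def)
  then have "newton_cap K \<le> ereal (LINT x|lebesgue. (norm (G x))\<^sup>2)"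
    unfolding newton_cap_def using v Cc_continuous by (intro Inf_lower) blast
  also have "(LINT x|lebesgue. (norm (G x))\<^sup>2) = (\<Sum>j\<in>Basis. LINT x|lborel. (g j x)\<^sup>2)"
  proof (subst lb)
    show "(LINT x|lborel. (norm (G x))\<^sup>2) = (\<Sum>j\<in>Basis. LINT x|lborel. (g j x)\<^sup>2)"
      unfolding Gn using g by (intro Bochner_Integration.integral_sum Cc_integrable Cc_power2) auto
  qed simp
  also have "\<dots> \<le> (\<Sum>j\<in>(Basis :: 'a set). B)"
    using g by (intro sum_mono) auto
  finally show ?thesis by simp
qed

lemma newton_cap_nonneg: "0 \<le> newton_cap K"
  unfolding newton_cap_def by (intro Inf_greatest) auto

text \<open>The perimeter of \<open>nbhd F t\<close> is not known to be measurable in \<open>t\<close>, but \<open>nn_integral\<close> is by definition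
  a supremum over simple functions.\<close>
lemma nn_integral_bounded_truncation:
  fixes f :: "real \<Rightarrow> ennreal"
  assumes "ennreal N < (\<integral>\<^sup>+ t \<in> {s<..}. f t \<partial>lborel)" "0 \<le> N"
  obtains h B R where "h \<in> borel_measurable borel" "\<And>t. 0 \<le> h t" "\<And>t. h t \<le> B"
    "\<And>t. h t \<noteq> 0 \<Longrightarrow> s < t \<and> t \<le> R" "\<And>t. ennreal (h t) \<le> f t" "N < (LINT t|lborel. h t)"
proof -
  obtain g where g: "simple_function lborel g" "g \<le> (\<lambda>t. f t * indicator {s<..} t)" "\<And>t. g t < top"
      and gN: "ennreal N < integral\<^sup>S lborel g"
    using assms(1) unfolding nn_integral_def_finite less_SUP_iff by auto
  have [measurable]: "g \<in> borel_measurable borel"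
    using borel_measurable_simple_function[OF g(1)] by simp
  \<comment> \<open>The simple function \<open>g\<close> may have unbounded support. By monotone
    convergence its restriction to some \<open>{..real n}\<close> still has integral above
    \<open>N\<close>.\<close>
  have "(\<integral>\<^sup>+ t. g t \<partial>lborel) = (\<integral>\<^sup>+ t. (SUP n. g t * indicator {..real n} t) \<partial>lborel)"
  proof (rule nn_integral_cong)
    fix t
    obtain m where "t \<le> real m" using real_arch_simple by blast
    then have "g t \<le> (SUP n. g t * indicator {..real n} t)"
      by (intro SUP_upper2[of m]) auto
    moreover have "(SUP n. g t * indicator {..real n} t) \<le> g t"
      by (intro SUP_least) (auto simp: indicator_def)
    ultimately show "g t = (SUP n. g t * indicator {..real n} t)" by (rule antisym)
  qed
  also have "\<dots> = (SUP n. \<integral>\<^sup>+ t. g t * indicator {..real n} t \<partial>lborel)"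
    by (intro nn_integral_monotone_convergence_SUP)
       (auto simp: incseq_def le_fun_def indicator_def intro!: mult_left_mono)
  finally have "ennreal N < (SUP n. \<integral>\<^sup>+ t. g t * indicator {..real n} t \<partial>lborel)"
    using gN by (simp add: nn_integral_eq_simple_integral[OF g(1)])
  then obtain n where n: "ennreal N < (\<integral>\<^sup>+ t. g t * indicator {..real n} t \<partial>lborel)"
    unfolding less_SUP_iff by auto
  define h where "h = (\<lambda>t. enn2real (g t * indicator {..real n} t))"
  define B where "B = Max (enn2real ` range g)"
  have gf: "ennreal (enn2real (g t)) = g t" for t using g(3)[of t] by simp
  have hm [measurable]: "h \<in> borel_measurable borel" unfolding h_def by measurable
  have h0: "0 \<le> h t" for t by (simp add: h_def)
  have he: "ennreal (h t) = g t * indicator {..real n} t" for t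
    using gf[of t] by (auto simp: h_def indicator_def)
  have "finite (range g)" using g(1) by (auto simp: simple_function_def)
  then have "enn2real (g t) \<le> B" for t unfolding B_def by (intro Max_ge) auto
  then have hB: "h t \<le> B" for t
    using order_trans[of 0 "enn2real (g t)" B] by (auto simp: h_def indicator_def)
  have hf: "ennreal (h t) \<le> f t * indicator {s<..} t" for t
    using g(2)[THEN le_funD, of t] by (auto simp: he indicator_def split: if_splits)
  have hs: "s < t \<and> t \<le> real n" if "h t \<noteq> 0" for t
  proof -
    have "0 < ennreal (h t)" using that h0[of t] by (simp add: less_le)
    then show ?thesis
      using hf[of t] he[of t] by (cases "s < t"; cases "t \<le> real n") auto
  qed
  have "integrable lborel h"
    using h0 hB hs by (intro integrable_bounded_support[of h B s "real n"]) auto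
  then have "ennreal N < ennreal (LINT t|lborel. h t)"
    using n h0 by (simp add: nn_integral_eq_integral flip: he)
  then have "N < (LINT t|lborel. h t)"
    using assms(2) by (simp add: ennreal_less_iff)
  moreover have "ennreal (h t) \<le> f t" for t
    using hf[of t] by (cases "s < t") auto
  ultimately show ?thesis
    using that[of h B "real n"] hm h0 hB hs by blast
qed

text \<open>Only an inequality: at \<open>0\<close> and at infinity the product is
  \<open>0\<close>.\<close>

lemma ennreal_inverse_mult_le_1: "inverse (x::ennreal) * x \<le> 1"
proof (cases x)
  case (real r)
  then show ?thesis
    by (cases "r = 0") (auto simp: inverse_ennreal simp flip: ennreal_mult)
qed simp

text \<open>The profile \<open>u\<close> equals \<open>1\<close> up to distance \<open>s\<close>
  from \<open>F\<close> and has difference quotients of energy at most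
  \<open>8 * n\<^sup>2 / c\<close>. Mollifying in all \<open>n\<close> directions gives a competitor
  of energy at most \<open>8 * n^3 / c\<close>, and \<open>N < c\<close>.\<close>

lemma newton_cap_le_inverse_integral:
  fixes K F :: "'a::euclidean_space set"
  assumes F: "compact F" "F \<noteq> {}" "K \<subseteq> F" and s: "0 < s"
    and N: "0 < N" "ennreal N < (\<integral>\<^sup>+ t \<in> {s<..}. inverse (perimeter (nbhd F t)) \<partial>lborel)"
  shows "newton_cap K \<le> ereal (8 * (real DIM('a))^3 / N)"
proof -
  define n where "n = real DIM('a)"
  have n: "1 \<le> n" unfolding n_def using DIM_positive[where 'a='a] by linarith
  obtain h B R where hm [measurable]: "h \<in> borel_measurable borel" and h0: "\<And>t. 0 \<le> h t" and hB: "\<And>t. h t \<le> B"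
    and hs: "\<And>t. h t \<noteq> 0 \<Longrightarrow> s < t \<and> t \<le> R" and hP: "\<And>t. ennreal (h t) \<le> inverse (perimeter (nbhd F t))"
    and hN: "N < (LINT t|lborel. h t)"
    using nn_integral_bounded_truncation[OF N(2)] N(1) by auto
  define c where "c = (LINT t|lborel. h t)"
  define H where "H = (\<lambda>a. LINT t|lborel. indicator {a..} t * h t)"
  \<comment> \<open>The largest step for which the shell bound holds at all levels above
    \<open>s\<close>. It also gives \<open>n * \<epsilon> \<le> s\<close>, so averaging near
    \<open>K\<close> stays within distance \<open>s\<close> of \<open>F\<close>.\<close>
  define \<epsilon> where "\<epsilon> = s / (2 * n\<^sup>2)"
  define u where "u = (\<lambda>x. H (infdist x F) / c)"
  have c: "N < c" "0 < c" using hN N by (auto simp: c_def)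
  have \<epsilon>: "0 < \<epsilon>" "2 * n\<^sup>2 * \<epsilon> \<le> s" using s n by (auto simp: \<epsilon>_def)
  have hint: "integrable lborel h"
    using h0 hB hs by (intro integrable_bounded_support[of h B s R]) auto
  have iA: "integrable lborel (\<lambda>t. indicator A t * h t)" if "A \<in> sets borel" for A
    using integrable_mult_indicator[OF _ hint, of A] that by simp
  have Hlip: "\<bar>H a - H b\<bar> \<le> B * (b - a)" if "a \<le> b" for a b
  proof -
    have "H a - H b = (LINT t|lborel. indicator {a..} t * h t - indicator {b..} t * h t)"
      unfolding H_def by (intro Bochner_Integration.integral_diff[symmetric] iA) auto
    also have "\<dots> = (LINT t|lborel. indicator {a..<b} t * h t)"
      using that by (intro Bochner_Integration.integral_cong) (auto simp: indicator_def)
    finally have eq: "H a - H b = (LINT t|lborel. indicator {a..<b} t * h t)" .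
    moreover have "0 \<le> (LINT t|lborel. indicator {a..<b} t * h t)"
      using h0 by (intro integral_nonneg_AE) auto
    moreover have "(LINT t|lborel. indicator {a..<b} t * h t) \<le> (LINT t|lborel. B * indicator {a..<b} t)"
    proof (intro integral_mono iA integrable_mult_right)
      show "integrable lborel (indicator {a..<b} :: real \<Rightarrow> real)" using that by simp
      show "indicator {a..<b} t * h t \<le> B * indicator {a..<b} t" for t
        using hB by (simp add: indicator_def)
    qed simp
    ultimately show ?thesis using that by simp
  qed
  have "B-lipschitz_on UNIV H"
  proof (rule lipschitz_onI)
    show "0 \<le> B" using h0[of 0] hB[of 0] by linarith
    show "dist (H a) (H b) \<le> B * dist a b" for a b
      using Hlip[of a b] Hlip[of b a] by (cases "a \<le> b") (auto simp: dist_real_def abs_minus_commute)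
  qed
  then have cH: "continuous_on UNIV H" by (rule lipschitz_on_continuous_on)
  have H0: "H a = 0" if "R < a" for a
  proof -
    have "indicator {a..} t * h t = 0" for t
      using hs[of t] that by (cases "h t = 0") auto
    then show ?thesis
      by (simp only: H_def Bochner_Integration.integral_zero)
  qed
  \<comment> \<open>\<open>h\<close> vanishes up to \<open>s\<close>, so no mass is lost below that
    level.\<close>
  have H1: "H a = c" if "a \<le> s" for a
  proof -
    have "indicator {a..} t * h t = h t" for t
      using hs[of t] that by (cases "h t = 0") auto
    then show ?thesis by (simp only: H_def c_def)
  qed
  have u: "Cc u"
  proof -
    have "continuous_on UNIV u"
      unfolding u_def using c by (intro continuous_intros continuous_on_compose2[OF cH]) auto
    moreover obtain M where M: "\<And>x. x \<in> nbhd F R \<Longrightarrow> norm x \<le> M"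
      using compact_imp_bounded[OF compact_nbhd[OF F(1,2)]] bounded_iff by metis
    then have "u x = 0" if "M < norm x" for x
      using that H0[of "infdist x F"] by (force simp: nbhd_def u_def not_le)
    ultimately show ?thesis unfolding Cc_def by blast
  qed
  have u0: "0 \<le> u x" for x
    unfolding u_def H_def using c h0 by (intro divide_nonneg_pos integral_nonneg_AE) auto
  have u1: "1 \<le> u x" if "x \<in> {x. infdist x F \<le> s}" for x
    using that c H1 by (simp add: u_def)
  have uB: "(LINT x|lborel. ((u (x + \<epsilon> *\<^sub>R j) - u x) / \<epsilon>)\<^sup>2) \<le> 8 * n\<^sup>2 / c" if j: "j \<in> Basis" for j
  proof -
    let ?w = "\<lambda>x. (H (infdist (x + \<epsilon> *\<^sub>R j) F) - H (infdist x F))\<^sup>2"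
    have eq: "((u (x + \<epsilon> *\<^sub>R j) - u x) / \<epsilon>)\<^sup>2 = ?w x / (c\<^sup>2 * \<epsilon>\<^sup>2)" for x
      by (simp add: u_def power_divide power_mult_distrib flip: diff_divide_distrib)
    have "Cc (\<lambda>x. c * u x)" using Cc_mult[OF u, of "\<lambda>_. c"] by (simp add: mult.commute)
    then have "Cc (\<lambda>x. (c * u (x + \<epsilon> *\<^sub>R j) - c * u x)\<^sup>2)"
      by (intro Cc_power2 Cc_diff) (rule Cc_translate)
    then have wint: "integrable lborel ?w"
      using Cc_integrable c by (simp add: u_def)
    have "ennreal (LINT x|lborel. ?w x) = (\<integral>\<^sup>+ x. ennreal (?w x) \<partial>lborel)"
      using wint by (intro nn_integral_eq_integral[symmetric]) auto
    also have "\<dots> \<le> ennreal (8 * (real DIM('a))\<^sup>2 * \<epsilon>\<^sup>2 * (LINT t|lborel. h t))"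
    proof (rule increment_energy_le[OF F(1,2) hm h0 hB hs s])
      show "ennreal (h t) * perimeter (nbhd F t) \<le> 1" for t
        using order_trans[OF mult_right_mono[OF hP[of t]] ennreal_inverse_mult_le_1] by simp
      show "norm (\<epsilon> *\<^sub>R j) \<le> \<epsilon>" using j \<epsilon> by simp
    qed (use \<epsilon> in \<open>auto simp: n_def H_def\<close>)
    finally have "(LINT x|lborel. ?w x) \<le> 8 * n\<^sup>2 * \<epsilon>\<^sup>2 * c"
      using c n \<epsilon> by (subst (asm) ennreal_le_iff) (auto simp: n_def c_def)
    then have "(LINT x|lborel. ?w x) / (c\<^sup>2 * \<epsilon>\<^sup>2) \<le> 8 * n\<^sup>2 * \<epsilon>\<^sup>2 * c / (c\<^sup>2 * \<epsilon>\<^sup>2)"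
      by (intro divide_right_mono) auto
    \<comment> \<open>The powers of \<open>\<epsilon>\<close> cancel, leaving a bound that does not
      depend on \<open>s\<close>.\<close>
    also have "\<dots> = 8 * n\<^sup>2 / c"
      using c \<epsilon> by (simp add: power2_eq_square)
    finally show ?thesis unfolding eq by simp
  qed
  obtain v g where v: "Cc v" "\<forall>x. 0 \<le> v x"
      "\<forall>x. cball x (n * \<epsilon>) \<subseteq> {x. infdist x F \<le> s} \<longrightarrow> 1 \<le> v x"
    and g: "\<forall>j\<in>Basis. Cc (g j) \<and> weak_partial j v (g j) \<and> (LINT x|lborel. (g j x)\<^sup>2) \<le> 8 * n\<^sup>2 / c"
    using mollification_exists[OF u u0 u1 \<epsilon>(1) uB finite_Basis order_refl] unfolding n_def by blast
  have "1 \<le> v x" if "x \<in> K" for x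
  proof -
    have "n * 1 \<le> n * (2 * n)" using n by (intro mult_left_mono) auto
    then have "n * \<epsilon> \<le> 2 * n\<^sup>2 * \<epsilon>" using \<epsilon>(1) by (intro mult_right_mono) (auto simp: power2_eq_square)
    then have "n * \<epsilon> \<le> s" using \<epsilon>(2) by linarith
    moreover have "infdist y F \<le> dist x y" for y
      using infdist_le[of x F y] that F(3) by (auto simp: dist_commute)
    ultimately have "cball x (n * \<epsilon>) \<subseteq> {x. infdist x F \<le> s}"
      by (metis (mono_tags, lifting) mem_Collect_eq mem_cball order_trans subsetI)
    then show ?thesis using v(3) by blast
  qed
  then have "newton_cap K \<le> ereal (real DIM('a) * (8 * n\<^sup>2 / c))"
    using v g by (intro newton_cap_le[of v K g]) (auto simp: indicator_def)
  also have "real DIM('a) * (8 * n\<^sup>2 / c) = 8 * n^3 / c"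
    by (simp add: n_def power2_eq_square power3_eq_cube)
  also have "8 * n^3 / c \<le> 8 * n^3 / N"
    using c N n by (intro divide_left_mono) auto
  finally show ?thesis by (simp add: n_def)
qed

theorem theorem1:
  fixes K :: "'a::euclidean_space set"
  assumes "DIM('a) \<ge> 3"
    and "compact K" and "K \<noteq> {}"
    and "((\<lambda>s. \<integral>\<^sup>+ t \<in> {s<..}. inverse (perimeter (nbhd (filled K) t)) \<partial>lborel)
           \<longlongrightarrow> \<infinity>) (at_right (0::real))"
  shows "newton_cap K = 0"
proof (rule antisym[OF _ newton_cap_nonneg])
  let ?J = "\<lambda>s. \<integral>\<^sup>+ t \<in> {s<..}. inverse (perimeter (nbhd (filled K) t)) \<partial>lborel"
  have F: "compact (filled K)" "filled K \<noteq> {}" "K \<subseteq> filled K"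
    using compact_filled[OF assms(2)] assms(3) by auto
  show "newton_cap K \<le> 0"
  proof (rule ereal_le_epsilon2)
    fix e :: real assume e: "0 < e"
    \<comment> \<open>Chosen so that the capacity bound \<open>8 * n^3 / N\<close> is exactly
      \<open>e\<close>.\<close>
    define N where "N = 8 * (real DIM('a))^3 / e"
    have N: "0 < N" using e by (simp add: N_def)
    have "\<forall>\<^sub>F s in at_right 0. ennreal N < ?J s"
      using assms(4) by (rule order_tendstoD(1)) simp
    then have "\<forall>\<^sub>F s in at_right 0. 0 < s \<and> ennreal N < ?J s"
      by (intro eventually_conj eventually_at_right_less)
    then obtain s where "0 < s" "ennreal N < ?J s"
      using eventually_happens'[OF trivial_limit_at_right_real] by blast
    from newton_cap_le_inverse_integral[OF F this(1) N this(2)]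
    show "newton_cap K \<le> 0 + ereal e"
      using e by (simp add: N_def)
  qed
qed

end
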